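(* Let $\varphi=\frac{1+\sqrt5}{2}$ and $r_n=a_{n,n}$. Then, as $n\to\infty$, $$r_n=\frac{\varphi^{2n+2}}{2\sqrt[4]{5}\,\sqrt{\pi n}}+O\!\left(\frac{\varphi^{2n}}{n^{3/2}}\right).$$
   Context: For nonnegative integers $p,q$, $a_{p,q}$ denotes the number of ways to partition a set consisting of $p$ marked points on a line and $q$ marked points on a parallel line into pairs, joining the two points of each pair by a straight segment, such that no two segments have a common point (in particular, no endpoint lies on another segment). *)

theory Defs
  imports "HOL-Analysis.Analysis" "HOL-Library.Landau_Symbols"
begin

text \<open>The two parallel lines are distinct. Their position, and that of the points on
  them, is otherwise arbitrary.\<close>

definition marked_points :: "nat \<Rightarrow> nat \<Rightarrow> (real^2) set \<Rightarrow> (real^2) set \<Rightarrow> bool" where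
  "marked_points p q A B \<longleftrightarrow>
     finite A \<and> card A = p \<and> finite B \<and> card B = q \<and>
     (\<exists>L M. affine L \<and> aff_dim L = 1 \<and> affine M \<and> aff_dim M = 1 \<and>
        affine_parallel L M \<and> L \<noteq> M \<and> A \<subseteq> L \<and> B \<subseteq> M)"

text \<open>The segments are closed and every point of \<open>S\<close> is an endpoint of one of them, so
  disjointness also says that no point of \<open>S\<close> lies on the segment of another pair.\<close>

definition noncrossing_pairings :: "(real^2) set \<Rightarrow> (real^2) set set set" where
  "noncrossing_pairings S =
     {P. partition_on S P \<and> (\<forall>e\<in>P. card e = 2) \<and>
         (\<forall>x y u v. {x, y} \<in> P \<and> {u, v} \<in> P \<and> {x, y} \<noteq> {u, v} \<longrightarrow>
            closed_segment x y \<inter> closed_segment u v = {})}"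

end

theory Submission
  imports Defs "HOL-Computational_Algebra.Formal_Laurent_Series" "HOL-Real_Asymp.Real_Asymp"
begin

text \<open>
  In a noncrossing pairing the last points of the two lines are either joined to each other, or one
  of them is joined to its neighbour on its own line. Removing such an edge gives a recursion, and
  hence \<open>r\<^sub>n = \<Sum>\<^sub>i (n - i choose i)\<^sup>2\<close>. By Vandermonde the generating function is
  \<open>((1 - x - x\<^sup>2)\<^sup>2 - 4 x\<^sup>3)\<^bsup>-1/2\<^esup>\<close>, and the quartic factors as
  \<open>(1 - \<phi>\<^sup>2 x) (1 - \<phi>\<^sup>-\<^sup>2 x) (1 + x + x\<^sup>2)\<close>. So \<open>r\<^sub>n\<close> is \<open>\<phi>\<^bsup>2n\<^esup>\<close> times a convolution of
  \<open>c\<^sub>n = (2n choose n) / 4\<^sup>n\<close> with an exponentially decaying sequence \<open>w\<close>; since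
  \<open>c\<^bsub>n-k\<^esub> - c\<^sub>n = O((k + 1)\<^sup>3 n\<^bsup>-3/2\<^esup>)\<close>, the convolution is \<open>c\<^sub>n \<Sum>\<^sub>k w\<^sub>k + O(n\<^bsup>-3/2\<^esup>)\<close>, and Wallis'
  product gives \<open>c\<^sub>n = 1 / sqrt (\<pi> n) + O(n\<^bsup>-3/2\<^esup>)\<close>. The sum of \<open>w\<close> is the second factor of the
  generating function at \<open>\<phi>\<^sup>-\<^sup>2\<close>. That factor is written with \<open>1 + x + x\<^sup>2 = (1 - x\<^sup>3) / (1 - x)\<close> so
  that all series involved are real with coefficients in \<open>[-1, 1]\<close>.
\<close>

section \<open>Counting noncrossing pairings\<close>

text \<open>The number of words with \<open>k\<close> letters of length 1 and all others of length 2, of total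
  length \<open>p\<close>: on a line with \<open>p\<close> points, the letters of length 1 are the points joined to the other
  line.\<close>
fun dimer_count :: "nat \<Rightarrow> nat \<Rightarrow> nat" where
  "dimer_count 0 k = (if k = 0 then 1 else 0)"
| "dimer_count (Suc 0) k = (if k = 1 then 1 else 0)"
| "dimer_count (Suc (Suc p)) 0 = dimer_count p 0"
| "dimer_count (Suc (Suc p)) (Suc k) = dimer_count p (Suc k) + dimer_count (Suc p) k"

lemma dimer_count_eq_0: "p < k \<Longrightarrow> dimer_count p k = 0"
  by (induction p k rule: dimer_count.induct) auto

text \<open>A word with \<open>k\<close> short and \<open>i\<close> long letters is determined by
  the positions of the long ones among its \<open>k + i\<close> letters.\<close>

lemma dimer_count_even: "dimer_count (k + 2 * i) k = (k + i) choose i"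
proof (induction "k + 2 * i" k arbitrary: i rule: dimer_count.induct)
  case (2 k)
  then have "k = 1" "i = 0" by presburger+
  then show ?case by simp
next
  case (3 p)
  then obtain j where "i = Suc j" by (cases i) auto
  with 3 show ?case by auto
next
  case (4 p k)
  show ?case
  proof (cases i)
    case 0
    then show ?thesis using 4(2)[of 0] 4(3) by (auto simp: dimer_count_eq_0)
  next
    case (Suc j)
    then show ?thesis using 4(1)[of j] 4(2)[of i] 4(3) by (auto simp flip: 4(3))
  qed
qed (auto simp: dimer_count_eq_0)

lemma dimer_count_odd: "odd (p + k) \<Longrightarrow> dimer_count p k = 0"
  by (induction p k rule: dimer_count.induct) (auto simp: odd_pos)

text \<open>Removes the last letter, long or short. The guards absorb the boundary cases, so that
  one formula can be multiplied out in \<open>pairing_number_rec\<close>.\<close>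

lemma dimer_count_Suc:
  "dimer_count (Suc p) k = (if p \<ge> 1 then dimer_count (p - 1) k else 0)
     + (if k = 0 then 0 else dimer_count p (k - 1))"
  by (cases p; cases k) auto

text \<open>Points joined to the other line must be matched in order, and all others are joined to a
  neighbour, so a noncrossing pairing amounts to two words with equally many short letters.\<close>

definition pairing_number :: "nat \<Rightarrow> nat \<Rightarrow> nat" where
  "pairing_number p q = (\<Sum>k\<le>p. dimer_count p k * dimer_count q k)"

lemma pairing_number_eq:
  assumes "p \<le> n"
  shows "pairing_number p q = (\<Sum>k\<le>n. dimer_count p k * dimer_count q k)"
  unfolding pairing_number_def
  by (rule sum.mono_neutral_left) (use assms in \<open>auto simp: dimer_count_eq_0\<close>)

lemma pairing_number_commute: "pairing_number p q = pairing_number q p"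
  using pairing_number_eq[of p "p + q" q] pairing_number_eq[of q "p + q" p]
  by (simp add: mult.commute)

lemma pairing_number_0: 
  "pairing_number 0 0 = 1" "pairing_number (Suc 0) 0 = 0"
  "pairing_number (Suc (Suc p)) 0 = pairing_number p 0"
  "pairing_number 0 (Suc 0) = 0" "pairing_number 0 (Suc (Suc p)) = pairing_number 0 p"
proof -
  have "pairing_number p 0 = dimer_count p 0" for p
    unfolding pairing_number_def by (simp add: sum.delta if_distrib[of "\<lambda>x. _ * x"] cong: if_cong)
  then show "pairing_number 0 0 = 1" "pairing_number (Suc 0) 0 = 0"
    "pairing_number (Suc (Suc p)) 0 = pairing_number p 0"
    "pairing_number 0 (Suc 0) = 0" "pairing_number 0 (Suc (Suc p)) = pairing_number 0 p"
    by (auto simp: pairing_number_def)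
qed

text \<open>With each factor split as \<open>U + V\<close> by its last letter, this is
  \<open>(U + V) (U' + V') + U U' = U (U' + V') + (U + V) U' + V V'\<close>, summed over
  \<open>k\<close>. The overlap \<open>U U'\<close> stands on the left to avoid subtraction of
  naturals.\<close>

lemma pairing_number_rec:
  "pairing_number (Suc p) (Suc q)
     + (if p \<ge> 1 \<and> q \<ge> 1 then pairing_number (p - 1) (q - 1) else 0)
   = (if p \<ge> 1 then pairing_number (p - 1) (Suc q) else 0)
     + (if q \<ge> 1 then pairing_number (Suc p) (q - 1) else 0) + pairing_number p q"
proof -
  define n where "n = p + q"
  define U where "U p k = (if p \<ge> 1 then dimer_count (p - 1) k else 0)" for p k
  define V where "V p k = (if k = 0 then 0 else dimer_count p (k - 1))" for p k
  have T: "dimer_count (Suc p) k = U p k + V p k" for p k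
    unfolding U_def V_def by (rule dimer_count_Suc)
  \<comment> \<open>\<open>V\<close> shifts \<open>k\<close> by one and vanishes at 0, so the sum up
    to \<open>n\<close> becomes one up to \<open>Suc n\<close>, the common range of all five
    sums.\<close>
  have "pairing_number p q = (\<Sum>k\<le>Suc n. V p k * V q k)"
    by (subst sum.atMost_Suc_shift) (simp add: V_def n_def pairing_number_eq[of p "p + q" q])
  moreover have "(if p \<ge> 1 \<and> q \<ge> 1 then pairing_number (p - 1) (q - 1) else 0)
      = (\<Sum>k\<le>Suc n. U p k * U q k)"
    by (auto simp: U_def n_def simp del: sum.atMost_Suc intro!: pairing_number_eq)
  moreover have "(if p \<ge> 1 then pairing_number (p - 1) (Suc q) else 0)
      = (\<Sum>k\<le>Suc n. U p k * dimer_count (Suc q) k)"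
    by (auto simp: U_def n_def simp del: sum.atMost_Suc intro!: pairing_number_eq)
  moreover have "(if q \<ge> 1 then pairing_number (Suc p) (q - 1) else 0)
      = (\<Sum>k\<le>Suc n. dimer_count (Suc p) k * U q k)"
    by (auto simp add: U_def n_def pairing_number_eq[of "Suc p" "Suc (p + q)"]  simp del: sum.atMost_Suc)
  moreover have "pairing_number (Suc p) (Suc q) = (\<Sum>k\<le>Suc n. dimer_count (Suc p) k * dimer_count (Suc q) k)"
    by (rule pairing_number_eq) (simp add: n_def)
  ultimately show ?thesis
    by (simp only: T sum.distrib [symmetric]) (rule sum.cong, auto simp: algebra_simps)
qed

text \<open>Substitutes \<open>k = n - 2 * i\<close>, with \<open>i\<close> the number of long
  letters; values of \<open>k\<close> of the other parity contribute 0.\<close>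

lemma pairing_number_diag:
  "pairing_number n n = (\<Sum>i\<le>n. (n - i choose i)\<^sup>2)"
proof -
  have "(\<Sum>i\<le>n. (n - i choose i)\<^sup>2) = (\<Sum>i\<in>{i. 2 * i \<le> n}. (n - i choose i)\<^sup>2)"
    by (rule sum.mono_neutral_right) (auto simp: binomial_eq_0)
  also have "\<dots> = (\<Sum>i\<in>{i. 2 * i \<le> n}. (dimer_count n (n - 2 * i))\<^sup>2)"
  proof (rule sum.cong[OF refl])
    fix i assume "i \<in> {i. 2 * i \<le> n}"
    then show "(n - i choose i)\<^sup>2 = (dimer_count n (n - 2 * i))\<^sup>2"
      using dimer_count_even[of "n - 2 * i" i] by (simp add: numeral_2_eq_2)
  qed
  also have "\<dots> = (\<Sum>k\<in>{k. k \<le> n \<and> even (n + k)}. (dimer_count n k)\<^sup>2)"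
    by (rule sum.reindex_bij_witness[of _ "\<lambda>k. (n - k) div 2" "\<lambda>i. n - 2 * i"]) auto
  also have "\<dots> = (\<Sum>k\<le>n. (dimer_count n k)\<^sup>2)"
    by (rule sum.mono_neutral_left) (auto simp: dimer_count_odd)
  finally show ?thesis by (simp add: pairing_number_def power2_eq_square)
qed

section \<open>Pairings of a point set and removal of an edge\<close>

lemma finite_noncrossing_pairings: "finite S \<Longrightarrow> finite (noncrossing_pairings S)"
  by (rule finite_subset[of _ "Pow (Pow S)"])
    (auto simp: noncrossing_pairings_def partition_on_def)

lemma noncrossing_pairings_empty: "noncrossing_pairings {} = {{}}"
  by (auto simp: noncrossing_pairings_def partition_on_empty)

lemma noncrossing_pairings_partner:
  assumes "P \<in> noncrossing_pairings S" "x \<in> S"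
  obtains y where "y \<in> S" "y \<noteq> x" "{x, y} \<in> P"
proof -
  from assms obtain e where e: "e \<in> P" "x \<in> e" "card e = 2" "e \<subseteq> S"
    by (auto simp: noncrossing_pairings_def partition_on_def)
  then obtain y where "e = {x, y}" "y \<noteq> x" by (auto simp: card_2_iff)
  with e that show ?thesis by auto
qed

lemma noncrossing_pairings_edge:
  assumes "P \<in> noncrossing_pairings S" "{x, y} \<in> P"
  shows "x \<in> S" "y \<in> S" "x \<noteq> y"
  using assms by (fastforce simp: noncrossing_pairings_def partition_on_def)+

lemma noncrossing_pairings_disjoint:
  assumes "P \<in> noncrossing_pairings S" "{x, y} \<in> P" "{u, v} \<in> P" "{x, y} \<noteq> {u, v}"
  shows "closed_segment x y \<inter> closed_segment u v = {}"
  using assms by (auto simp: noncrossing_pairings_def)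

lemma noncrossing_pairings_edge_eq:
  assumes "P \<in> noncrossing_pairings S" "{x, y} \<in> P" "{u, v} \<in> P"
    "z \<in> closed_segment x y" "z \<in> closed_segment u v"
  shows "{x, y} = {u, v}"
  using noncrossing_pairings_disjoint[OF assms(1-3)] assms(4,5) by blast

text \<open>Convexity puts every segment between remaining points inside \<open>K\<close>, so
  putting \<open>{x, y}\<close> back can never create an intersection.\<close>

lemma noncrossing_pairings_remove_edge:
  assumes xy: "x \<in> S" "y \<in> S" "x \<noteq> y"
    and K: "convex K" "S - {x, y} \<subseteq> K" "closed_segment x y \<inter> K = {}"
  shows "{P \<in> noncrossing_pairings S. {x, y} \<in> P} = insert {x, y} ` noncrossing_pairings (S - {x, y})"
    and "inj_on (insert {x, y}) (noncrossing_pairings (S - {x, y}))"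
proof (intro equalityI subsetI)
  fix P assume "P \<in> {P \<in> noncrossing_pairings S. {x, y} \<in> P}"
  then have P: "P \<in> noncrossing_pairings S" "{x, y} \<in> P" by auto
  then have "partition_on S P" by (simp add: noncrossing_pairings_def)
  have "e \<inter> {x, y} = {}" if "e \<in> P - {{x, y}}" for e
    using partition_onD2[OF \<open>partition_on S P\<close>] P(2) that by (auto dest: disjointD)
  then have "disjnt {x, y} (\<Union>(P - {{x, y}}))" by (auto simp: disjnt_def)
  from partition_on_insert[OF this, of S]
  have part: "partition_on (S - {x, y}) (P - {{x, y}})"
    using P(2) \<open>partition_on S P\<close> by (simp add: insert_absorb)
  then have "P - {{x, y}} \<in> noncrossing_pairings (S - {x, y})"
    using P(1) by (auto simp: noncrossing_pairings_def)
  moreover have "P = insert {x, y} (P - {{x, y}})" using P by auto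
  ultimately show "P \<in> insert {x, y} ` noncrossing_pairings (S - {x, y})" by blast
next
  fix P assume "P \<in> insert {x, y} ` noncrossing_pairings (S - {x, y})"
  then obtain Q where Q: "P = insert {x, y} Q" "Q \<in> noncrossing_pairings (S - {x, y})" by blast
  then have Q': "partition_on (S - {x, y}) Q" by (simp add: noncrossing_pairings_def)
  have "partition_on S P"
    using Q' xy unfolding Q partition_on_def by (auto simp: disjoint_def)
  moreover have "\<forall>e\<in>P. card e = 2"
    using Q xy by (auto simp: noncrossing_pairings_def)
  moreover have sep: "closed_segment x y \<inter> closed_segment u v = {}" if "{u, v} \<in> Q" for u v
  proof -
    have "u \<in> K" "v \<in> K" using noncrossing_pairings_edge[OF Q(2) that] K(2) by auto
    then have "closed_segment u v \<subseteq> K" using K(1) by (rule closed_segment_subset)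
    then show ?thesis using K(3) by blast
  qed
  have "closed_segment u v \<inter> closed_segment u' v' = {}"
    if uv: "{u, v} \<in> P" "{u', v'} \<in> P" "{u, v} \<noteq> {u', v'}" for u v u' v'
  proof -
    have seg: "closed_segment u v = closed_segment x y" if "{u, v} = {x, y}" for u v
      using that by (auto simp: doubleton_eq_iff closed_segment_commute)
    consider "{u, v} = {x, y}" "{u', v'} \<in> Q" | "{u', v'} = {x, y}" "{u, v} \<in> Q"
      | "{u, v} \<in> Q" "{u', v'} \<in> Q"
      using uv Q(1) by auto
    then show ?thesis
    proof cases
      case 1
      then show ?thesis using sep[OF 1(2)] by (simp only: seg[OF 1(1)])
    next
      case 2
      then show ?thesis using sep[OF 2(2)] by (simp only: seg[OF 2(1)] Int_commute)
    next
      case 3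
      then show ?thesis using noncrossing_pairings_disjoint[OF Q(2)] uv(3) by blast
    qed
  qed
  ultimately show "P \<in> {P \<in> noncrossing_pairings S. {x, y} \<in> P}"
    using Q by (auto simp: noncrossing_pairings_def)
next
  have "{x, y} \<notin> Q" if "Q \<in> noncrossing_pairings (S - {x, y})" for Q
    using noncrossing_pairings_edge(1)[OF that, of x y] by auto
  then show "inj_on (insert {x, y}) (noncrossing_pairings (S - {x, y}))"
    by (intro inj_onI) (metis insert_ident)
qed

text \<open>The lines are \<open>f = c\<close> and \<open>f = d\<close>, and \<open>g\<close> is a coordinate along both of them.\<close>
locale two_lines =
  fixes f g :: "real^2 \<Rightarrow> real" and c d :: real
  assumes lin_f: "linear f" and lin_g: "linear g"
    and inj: "\<And>x y. f x = f y \<Longrightarrow> g x = g y \<Longrightarrow> x = y"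
    and cd: "c \<noteq> d"
begin

section \<open>Segments between points of two parallel lines\<close>

lemma f_comb: "f ((1 - t) *\<^sub>R x + t *\<^sub>R y) = (1 - t) * f x + t * f y"
  and g_comb: "g ((1 - t) *\<^sub>R x + t *\<^sub>R y) = (1 - t) * g x + t * g y"
  by (simp_all add: lin_f lin_g linear_add linear_scale)

lemma between_in_segment:
  assumes "f u = f w" "f v = f w" "g u \<le> g v" "g v \<le> g w"
  shows "v \<in> closed_segment u w"
proof (cases "g u = g w")
  case True
  then have "v = u" using assms by (intro inj) auto
  then show ?thesis by simp
next
  case False
  define t where "t = (g v - g u) / (g w - g u)"
  have t: "0 \<le> t" "t \<le> 1" using assms False by (auto simp: t_def)
  have "t * (g w - g u) = g v - g u" using False by (simp add: t_def)
  then have "v = (1 - t) *\<^sub>R u + t *\<^sub>R w"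
    by (intro inj) (use assms in \<open>auto simp only: f_comb g_comb, auto simp: algebra_simps\<close>)
  with t show ?thesis by (auto simp: in_segment)
qed

lemma segments_cross:
  assumes "f u = f u'" "f v = f v'" "g u < g u'" "g v' < g v"
  obtains z where "z \<in> closed_segment u v" "z \<in> closed_segment u' v'"
proof -
  \<comment> \<open>The parameter at which \<open>g\<close> agrees on the two segments;
    \<open>f\<close> agrees at every parameter because the endpoints lie on the same lines.\<close>
  define t where "t = (g u' - g u) / ((g u' - g u) + (g v - g v'))"
  have t: "0 \<le> t" "t \<le> 1" using assms by (auto simp: t_def)
  have "t * ((g u' - g u) + (g v - g v')) = g u' - g u" using assms by (simp add: t_def)
  then have "(1 - t) *\<^sub>R u + t *\<^sub>R v = (1 - t) *\<^sub>R u' + t *\<^sub>R v'"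
    by (intro inj) (use assms in \<open>auto simp only: f_comb g_comb, auto simp: algebra_simps\<close>)
  with t that show ?thesis by (auto simp: in_segment)
qed

definition is_top :: "(real^2) set \<Rightarrow> real^2 \<Rightarrow> bool" where
  "is_top A a \<longleftrightarrow> a \<in> A \<and> (\<forall>x\<in>A. g x \<le> g a)"

lemma ex_is_top:
  assumes "finite A" "A \<noteq> {}"
  obtains a where "is_top A a"
proof -
  from assms have "Max (g ` A) \<in> g ` A" by simp
  then obtain a where "a \<in> A" "g a = Max (g ` A)" by auto
  with assms have "is_top A a" unfolding is_top_def by simp
  then show ?thesis by (rule that)
qed

lemma is_top_less:
  assumes "is_top A a" "x \<in> A" "x \<noteq> a" "\<forall>x\<in>A. f x = k"
  shows "g x < g a"
  using assms inj[of x a] unfolding is_top_def by force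

text \<open>A point of \<open>A\<close> beyond \<open>x\<close>, other than \<open>a\<close>, would
  lie on the segment from \<open>a\<close> to \<open>x\<close>, and its own edge would then meet
  that segment.\<close>

lemma same_line_edge:
  assumes A: "\<forall>x\<in>A. f x = c" and S: "A \<subseteq> S" and P: "P \<in> noncrossing_pairings S"
    and a: "is_top A a" and x: "x \<in> A" "{a, x} \<in> P"
  shows "is_top (A - {a}) x"
proof -
  have "x \<noteq> a" using noncrossing_pairings_edge(3)[OF P x(2)] by auto
  moreover have "g y \<le> g x" if y: "y \<in> A" "y \<noteq> a" for y
  proof (rule ccontr)
    assume "\<not> g y \<le> g x"
    then have "y \<in> closed_segment x a"
      using a A x y by (intro between_in_segment) (auto simp: is_top_def)
    then have "y \<in> closed_segment a x" by (simp add: closed_segment_commute)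
    moreover obtain z where "{y, z} \<in> P"
      using noncrossing_pairings_partner[OF P, of y] y S by auto
    ultimately have "{a, x} = {y, z}"
      using noncrossing_pairings_edge_eq[OF P x(2)] by auto
    with y \<open>\<not> g y \<le> g x\<close> show False by auto
  qed
  ultimately show ?thesis using x by (auto simp: is_top_def)
qed

text \<open>If both last points had partners across but were not joined to each other, the two edges
  would cross, since each runs from the last point of one line to an earlier point of the
  other.\<close>

lemma cross_line_edges:
  assumes A: "\<forall>x\<in>A. f x = c" and B: "\<forall>x\<in>B. f x = d"
    and P: "P \<in> noncrossing_pairings S"
    and a: "is_top A a" and b: "is_top B b"
    and x: "x \<in> A" "{b, x} \<in> P" and y: "y \<in> B" "{a, y} \<in> P"
  shows "y = b"
proof (rule ccontr)
  assume "y \<noteq> b"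
  have ab: "a \<in> A" "b \<in> B" using a b by (auto simp: is_top_def)
  have "x \<noteq> a"
  proof
    assume "x = a"
    then have "{a, b} = {a, y}"
      by (intro noncrossing_pairings_edge_eq[OF P, of _ _ _ _ a]) (use x y in \<open>auto simp: insert_commute\<close>)
    with \<open>y \<noteq> b\<close> show False by (auto simp: doubleton_eq_iff)
  qed
  then have "g x < g a" "g y < g b" using is_top_less[OF a] is_top_less[OF b] A B x y \<open>y \<noteq> b\<close> by auto
  then obtain z where "z \<in> closed_segment x b" "z \<in> closed_segment a y"
    using segments_cross[of x a b y] A B ab x y by auto
  then have "{a, y} = {b, x}"
    by (intro noncrossing_pairings_edge_eq[OF P y(2) x(2)]) (auto simp: closed_segment_commute)
  with A B ab cd x y \<open>y \<noteq> b\<close> show False by (auto simp: doubleton_eq_iff)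
qed

lemma same_line_pairings:
  assumes A: "\<forall>x\<in>A. f x = c" and B: "\<forall>x\<in>B. f x = d"
    and a: "is_top A a" and a': "is_top (A - {a}) a'"
  shows "{P \<in> noncrossing_pairings (A \<union> B). {a, a'} \<in> P}
           = insert {a, a'} ` noncrossing_pairings ((A - {a, a'}) \<union> B)"
    and "inj_on (insert {a, a'}) (noncrossing_pairings ((A - {a, a'}) \<union> B))"
proof -
  have aa': "a \<in> A" "a' \<in> A" "a \<noteq> a'" "g a' \<le> g a" using a a' by (auto simp: is_top_def)
  have AB: "A \<inter> B = {}" using A B cd by force
  \<comment> \<open>The open half-plane on the side of the other line, together with the part of the
    line \<open>f = c\<close> before \<open>a'\<close>. Dividing by \<open>d - c\<close> makes that
    side positive whatever the order of \<open>c\<close> and \<open>d\<close>.\<close>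
  define K where "K = {x. 0 < (f x - c) / (d - c)} \<union> {x. f x = c \<and> g x < g a'}"
  have "convex K"
    unfolding convex_alt
  proof (intro ballI allI impI)
    fix x y u assume xy: "x \<in> K" "y \<in> K" and u: "0 \<le> u \<and> u \<le> (1::real)"
    define F where "F x = (f x - c) / (d - c)" for x
    have K: "x \<in> K \<longleftrightarrow> 0 < F x \<or> F x = 0 \<and> g x < g a'" for x
      using cd by (auto simp: K_def F_def)
    have F: "F ((1 - u) *\<^sub>R x + u *\<^sub>R y) = (1 - u) * F x + u * F y"
      by (simp only: F_def f_comb) (simp add: diff_divide_distrib add_divide_distrib algebra_simps)
    have lt: "(1 - u) * s + u * t < r" if "s < r" "t < r" for s t r :: real
      using convex_bound_lt[of s r t "1 - u" u] that u by auto
    consider "F x > 0" "F y > 0" | "F x = 0" "F y > 0" "g x < g a'" 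
      | "F x > 0" "F y = 0" "g y < g a'" | "F x = 0" "F y = 0" "g x < g a'" "g y < g a'"
      using xy by (auto simp: K)
    then show "(1 - u) *\<^sub>R x + u *\<^sub>R y \<in> K"
    proof cases
      case 1
      then have "(1 - u) * F x + u * F y > 0"
        using lt[of "- F x" 0 "- F y"] by simp
      then show ?thesis by (simp add: K F)
    next
      case 2
      then show ?thesis using u by (cases "u = 0") (auto simp: K F)
    next
      case 3
      then show ?thesis using u by (cases "u = 1") (auto simp: K F)
    next
      case 4
      then show ?thesis using lt[of "g x" "g a'" "g y"] by (simp add: K F g_comb)
    qed
  qed
  moreover have "A \<union> B - {a, a'} \<subseteq> K"
    using is_top_less[OF a'] A B cd by (auto simp: K_def)
  moreover have "closed_segment a a' \<inter> K = {}"
  proof -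
    have "x \<notin> K" if "x \<in> closed_segment a a'" for x
    proof -
      from that obtain t where t: "0 \<le> t" "t \<le> 1" "x = (1 - t) *\<^sub>R a + t *\<^sub>R a'"
        by (auto simp: in_segment)
      have "(1 - t) * (g a - g a') \<ge> 0" using t aa' by simp
      then have "g x \<ge> g a'" "f x = c" using A aa'
        by (simp_all only: t(3) f_comb g_comb) (simp_all add: algebra_simps)
      then show ?thesis by (auto simp: K_def)
    qed
    then show ?thesis by auto
  qed
  ultimately have *: "{P \<in> noncrossing_pairings (A \<union> B). {a, a'} \<in> P}
           = insert {a, a'} ` noncrossing_pairings (A \<union> B - {a, a'})"
     "inj_on (insert {a, a'}) (noncrossing_pairings (A \<union> B - {a, a'}))"
    using aa' by (intro noncrossing_pairings_remove_edge[where K = K]; auto)+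
  have "A \<union> B - {a, a'} = (A - {a, a'}) \<union> B" using aa' AB by auto
  with * show "{P \<in> noncrossing_pairings (A \<union> B). {a, a'} \<in> P}
           = insert {a, a'} ` noncrossing_pairings ((A - {a, a'}) \<union> B)"
     "inj_on (insert {a, a'}) (noncrossing_pairings ((A - {a, a'}) \<union> B))" by simp_all
qed

lemma cross_line_pairings:
  assumes A: "\<forall>x\<in>A. f x = c" and B: "\<forall>x\<in>B. f x = d"
    and a: "is_top A a" and b: "is_top B b"
  shows "{P \<in> noncrossing_pairings (A \<union> B). {a, b} \<in> P}
           = insert {a, b} ` noncrossing_pairings ((A - {a}) \<union> (B - {b}))"
    and "inj_on (insert {a, b}) (noncrossing_pairings ((A - {a}) \<union> (B - {b})))"
proof -
  have ab: "a \<in> A" "b \<in> B" using a b by (auto simp: is_top_def)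
  have AB: "A \<inter> B = {}" using A B cd by force
  \<comment> \<open>The slope for which \<open>h\<close> is constant on the segment from
    \<open>a\<close> to \<open>b\<close>. All other points lie strictly on the side
    \<open>h x < h a\<close>, because on each line \<open>h\<close> differs from \<open>g\<close> by
    a constant.\<close>
  define m where "m = (g b - g a) / (d - c)"
  define h where "h x = g x - m * f x" for x
  have h: "linear h" unfolding h_def
    by (intro linear_compose_sub lin_g linear_compose_scale_right[OF lin_f, of m, simplified])
  have "m * (d - c) = g b - g a" using cd by (simp add: m_def)
  then have hab: "h b = h a" using A B ab by (simp add: h_def algebra_simps)
  have K: "convex {x. h x < h a}"
    using convex_linear_vimage[OF h, of "{..<h a}"] by (simp add: vimage_def)
  have AK: "A \<union> B - {a, b} \<subseteq> {x. h x < h a}"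
  proof
    fix x assume "x \<in> A \<union> B - {a, b}"
    then consider "x \<in> A" "x \<noteq> a" | "x \<in> B" "x \<noteq> b" by auto
    then show "x \<in> {x. h x < h a}"
    proof cases
      case 1
      then show ?thesis using is_top_less[OF a _ _ A] A ab by (simp add: h_def)
    next
      case 2
      then show ?thesis using is_top_less[OF b _ _ B] B ab by (simp flip: hab) (simp add: h_def)
    qed
  qed
  have sK: "closed_segment a b \<inter> {x. h x < h a} = {}"
  proof -
    have "\<not> h x < h a" if "x \<in> closed_segment a b" for x
    proof -
      from that obtain u where "x = (1 - u) *\<^sub>R a + u *\<^sub>R b" by (auto simp: in_segment)
      then have "h x = (1 - u) * h a + u * h b" using h by (simp add: linear_add linear_scale)
      then show ?thesis by (simp add: hab algebra_simps)
    qed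
    then show ?thesis by auto
  qed
  have "a \<in> A \<union> B" "b \<in> A \<union> B" "a \<noteq> b" using ab AB by auto
  note * = noncrossing_pairings_remove_edge[OF this K AK sK]
  have "A \<union> B - {a, b} = (A - {a}) \<union> (B - {b})" using ab AB by auto
  with * show "{P \<in> noncrossing_pairings (A \<union> B). {a, b} \<in> P}
           = insert {a, b} ` noncrossing_pairings ((A - {a}) \<union> (B - {b}))"
     "inj_on (insert {a, b}) (noncrossing_pairings ((A - {a}) \<union> (B - {b})))" by simp_all
qed

end

text \<open>Exchanging the lines lets statements proved for \<open>A\<close> serve for
  \<open>B\<close> as well.\<close>

sublocale two_lines \<subseteq> swap: two_lines f g d c
  by (rule two_lines.intro) (use lin_f lin_g inj cd in auto)

context two_lines
begin

section \<open>The counting recursion\<close>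

text \<open>The partner of \<open>a\<close> on its own line must be the preceding point, and
  deleting both leaves \<open>card A - 2\<close> points. Assumption \<open>N\<close> concerns
  smaller subsets of \<open>A\<close> with \<open>B\<close> fixed, so an induction on the total
  number of points can supply it for either line.\<close>

lemma card_same_line_pairings:
  assumes A: "finite A" "\<forall>x\<in>A. f x = c" and B: "finite B" "\<forall>x\<in>B. f x = d" and a: "is_top A a"
    and N: "\<And>A'. card A' < card A \<Longrightarrow> A' \<subseteq> A \<Longrightarrow> card (noncrossing_pairings (A' \<union> B)) = pairing_number (card A') (card B)"
  shows "card {P \<in> noncrossing_pairings (A \<union> B). \<exists>x\<in>A. {a, x} \<in> P}
           = (if card A \<ge> 2 then pairing_number (card A - 2) (card B) else 0)"
proof (cases "A = {a}")
  case True
  then have *: "{P \<in> noncrossing_pairings (A \<union> B). \<exists>x\<in>A. {a, x} \<in> P} = {}"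
    using noncrossing_pairings_edge(3)[of _ _ a a] by auto
  from True have "card A = 1" by simp
  then show ?thesis unfolding * by simp
next
  case False
  have aA: "a \<in> A" using a by (simp add: is_top_def)
  with False obtain a' where a': "is_top (A - {a}) a'"
    using ex_is_top[of "A - {a}"] A by blast
  have *: "x = a'" if "is_top (A - {a}) x" for x
    using that a' A inj[of x a'] unfolding is_top_def by force
  have aa': "a' \<in> A" "a' \<noteq> a" using a' by (auto simp: is_top_def)
  have "card {a, a'} \<le> card A" using aa' aA A by (intro card_mono) auto
  then have c: "card A \<ge> 2" "card (A - {a, a'}) = card A - 2"
    using aa' aA A by (simp_all add: card_Diff_subset)
  have "{P \<in> noncrossing_pairings (A \<union> B). \<exists>x\<in>A. {a, x} \<in> P} = {P \<in> noncrossing_pairings (A \<union> B). {a, a'} \<in> P}"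
    using same_line_edge[OF A(2) _ _ a, of "A \<union> B"] * aa' by fastforce
  also have "card \<dots> = card (noncrossing_pairings ((A - {a, a'}) \<union> B))"
    using same_line_pairings[OF A(2) B(2) a a'] by (simp add: card_image)
  also have "\<dots> = pairing_number (card A - 2) (card B)"
    using N[of "A - {a, a'}"] c by auto
  finally show ?thesis using c by simp
qed

end

context two_lines
begin

text \<open>Inclusion-exclusion over the edges at the last points \<open>a\<close> and
  \<open>b\<close>: in \<open>X a\<close> the partner of \<open>a\<close> is on its own line, in
  \<open>Y b\<close> that of \<open>b\<close> is, and in \<open>Z\<close> the two are joined. Only
  \<open>X a\<close> and \<open>Y b\<close> overlap, and the counts match
  \<open>pairing_number_rec\<close>.\<close>

theorem card_noncrossing_pairings:
  assumes "finite A" "\<forall>x\<in>A. f x = c" "finite B" "\<forall>x\<in>B. f x = d"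
  shows "card (noncrossing_pairings (A \<union> B)) = pairing_number (card A) (card B)"
  using assms
proof (induction "card A + card B" arbitrary: A B rule: less_induct)
  case less
  note A = less.prems(1,2) and B = less.prems(3,4)
  let ?N = noncrossing_pairings
  have AB: "A \<inter> B = {}" using A B cd by force
  have IH: "card (?N (A' \<union> B')) = pairing_number (card A') (card B')"
    if "A' \<subseteq> A" "B' \<subseteq> B" "card A' + card B' < card A + card B" for A' B'
    using less.hyps[OF that(3)] that(1,2) A B by (auto intro: finite_subset)
  have fin: "finite (?N (A \<union> B))" using A B by (intro finite_noncrossing_pairings) auto
  define X where "X a = {P \<in> ?N (A \<union> B). \<exists>x\<in>A. {a, x} \<in> P}" for a
  define Y where "Y b = {P \<in> ?N (A \<union> B). \<exists>x\<in>B. {b, x} \<in> P}" for b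
  have cX: "card (X a) = (if card A \<ge> 2 then pairing_number (card A - 2) (card B) else 0)"
    if "is_top A a" for a
    unfolding X_def using card_same_line_pairings[OF A B that] IH by auto
  have cY: "card (Y b) = (if card B \<ge> 2 then pairing_number (card A) (card B - 2) else 0)"
    if "is_top B b" for b
    using swap.card_same_line_pairings[OF B A that] IH[of A]
    by (auto simp: Y_def Un_commute pairing_number_commute)
  consider "A = {}" "B = {}" | "A \<noteq> {}" "B = {}" | "A = {}" "B \<noteq> {}" | "A \<noteq> {}" "B \<noteq> {}" by blast
  then show ?case
  proof cases
    case 1
    then show ?thesis by (simp add: noncrossing_pairings_empty pairing_number_0)
  next
    case 2
    obtain a where a: "is_top A a" using ex_is_top A 2 by blast
    have "P \<in> X a" if P: "P \<in> ?N (A \<union> B)" for P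
    proof -
      obtain y where "y \<in> A \<union> B" "{a, y} \<in> P"
        using noncrossing_pairings_partner[OF P, of a] a by (auto simp: is_top_def)
      with 2 P show ?thesis by (auto simp: X_def)
    qed
    then have "?N (A \<union> B) = X a" by (auto simp: X_def)
    then show ?thesis using cX[OF a] 2 A pairing_number_0
      by (cases "card A"; cases "card A - 1") auto
  next
    case 3
    obtain b where b: "is_top B b" using ex_is_top B 3 by blast
    have "P \<in> Y b" if P: "P \<in> ?N (A \<union> B)" for P
    proof -
      obtain y where "y \<in> A \<union> B" "{b, y} \<in> P"
        using noncrossing_pairings_partner[OF P, of b] b by (auto simp: is_top_def)
      with 3 P show ?thesis by (auto simp: Y_def)
    qed
    then have "?N (A \<union> B) = Y b" by (auto simp: Y_def)
    then show ?thesis using cY[OF b] 3 B pairing_number_0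
      by (cases "card B"; cases "card B - 1") auto
  next
    case 4
    obtain a where a: "is_top A a" using ex_is_top A 4 by blast
    obtain b where b: "is_top B b" using ex_is_top B 4 by blast
    have ab: "a \<in> A" "b \<in> B" using a b by (auto simp: is_top_def)
    define Z where "Z = {P \<in> ?N (A \<union> B). {a, b} \<in> P}"
    have "?N (A \<union> B) \<subseteq> X a \<union> Y b \<union> Z"
    proof
      fix P assume P: "P \<in> ?N (A \<union> B)"
      obtain y where y: "y \<in> A \<union> B" "{a, y} \<in> P"
        using noncrossing_pairings_partner[OF P, of a] ab by auto
      obtain x where x: "x \<in> A \<union> B" "{b, x} \<in> P"
        using noncrossing_pairings_partner[OF P, of b] ab by auto
      show "P \<in> X a \<union> Y b \<union> Z"
        using cross_line_edges[OF A(2) B(2) P a b, of x y] x y P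
        by (auto simp: X_def Y_def Z_def)
    qed
    then have U: "?N (A \<union> B) = (X a \<union> Y b) \<union> Z" by (auto simp: X_def Y_def Z_def)
    have unique: "x = y" if "P \<in> ?N (A \<union> B)" "{z, x} \<in> P" "{z, y} \<in> P" for P x y z
      using noncrossing_pairings_edge_eq[OF that, of z] by (auto simp: doubleton_eq_iff)
    have disj: "(X a \<union> Y b) \<inter> Z = {}"
    proof -
      have False if P: "P \<in> ?N (A \<union> B)" "{a, b} \<in> P" and e: "(x \<in> A \<and> {a, x} \<in> P) \<or> (x \<in> B \<and> {b, x} \<in> P)" for P x
        using e
      proof
        assume "x \<in> A \<and> {a, x} \<in> P"
        then show False using unique[OF P(1), of a x b] P(2) ab AB by auto
      next
        assume "x \<in> B \<and> {b, x} \<in> P"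
        then show False using unique[OF P(1), of b x a] P(2) ab AB by (auto simp: insert_commute)
      qed
      then show ?thesis unfolding X_def Y_def Z_def by blast
    qed
    have cZ: "card Z = pairing_number (card A - 1) (card B - 1)"
    proof -
      have lt: "card (A - {a}) < card A" "card (B - {b}) < card B"
        by (simp_all only: card_Diff1_less ab A B)
      have "card Z = card (?N ((A - {a}) \<union> (B - {b})))"
        using cross_line_pairings[OF A(2) B(2) a b] by (simp add: Z_def card_image)
      also have "\<dots> = pairing_number (card (A - {a})) (card (B - {b}))"
        using lt by (intro IH) auto
      finally show ?thesis using ab A B by simp
    qed
    \<comment> \<open>First strip the edge at \<open>a\<close>, then count the possible edges at
      \<open>b\<close> in what remains by the mirrored lemma; the stripped edge lies within
      \<open>A\<close> and does not affect the condition on \<open>b\<close>.\<close>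
    have cXY: "card (X a \<inter> Y b) =
        (if card A \<ge> 2 \<and> card B \<ge> 2 then pairing_number (card A - 2) (card B - 2) else 0)"
    proof (cases "A = {a}")
      case True
      then have "X a = {}"
        using noncrossing_pairings_edge(3)[of _ _ a a] by (auto simp: X_def)
      with True show ?thesis by simp
    next
      case False
      with ab obtain a' where a': "is_top (A - {a}) a'"
        using ex_is_top[of "A - {a}"] A by blast
      have *: "x = a'" if "is_top (A - {a}) x" for x
        using that a' A inj[of x a'] unfolding is_top_def by force
      have aa': "a' \<in> A" "a' \<noteq> a" using a' by (auto simp: is_top_def)
      have "card {a, a'} \<le> card A" using aa' ab A by (intro card_mono) auto
      then have c: "card A \<ge> 2" "card (A - {a, a'}) = card A - 2"
        using aa' ab A by (simp_all add: card_Diff_subset)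
      let ?S = "A - {a, a'}"
      have "X a = {P \<in> ?N (A \<union> B). {a, a'} \<in> P}"
        using same_line_edge[OF A(2) _ _ a, of "A \<union> B"] * aa' by (fastforce simp: X_def)
      also have "\<dots> = insert {a, a'} ` ?N (?S \<union> B)"
        by (rule same_line_pairings[OF A(2) B(2) a a'])
      finally have X: "X a = insert {a, a'} ` ?N (?S \<union> B)" .
      have "X a \<inter> Y b = {P \<in> X a. \<exists>x\<in>B. {b, x} \<in> P}" by (auto simp: X_def Y_def)
      also have "\<dots> = insert {a, a'} ` {P \<in> ?N (?S \<union> B). \<exists>x\<in>B. {b, x} \<in> P}"
      proof -
        have "{b, x} \<noteq> {a, a'}" for x using AB ab aa' by (auto simp: doubleton_eq_iff)
        then show ?thesis by (simp only: X Compr_image_eq insert_iff) simp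
      qed
      finally have XY: "X a \<inter> Y b = \<dots>" .
      have "card (X a \<inter> Y b) = card {P \<in> ?N (?S \<union> B). \<exists>x\<in>B. {b, x} \<in> P}"
        unfolding XY
        by (intro card_image inj_on_subset[OF same_line_pairings(2)[OF A(2) B(2) a a']]) blast
      also have "\<dots> = (if card B \<ge> 2 then pairing_number (card B - 2) (card ?S) else 0)"
      proof -
        have "card (?N (A' \<union> ?S)) = pairing_number (card A') (card ?S)"
          if "card A' < card B" "A' \<subseteq> B" for A'
          using IH[of ?S A'] that c by (simp add: Un_commute[of A'] pairing_number_commute[of "card A'"])
        then show ?thesis
          using swap.card_same_line_pairings[OF B _ _ b, of ?S] A by (simp add: Un_commute[of ?S])
      qed
      finally show ?thesis using c by (auto simp: pairing_number_commute)
    qed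
    have U': "card (?N (A \<union> B)) + card (X a \<inter> Y b) = card (X a) + card (Y b) + card Z"
      using card_Un_disjoint[OF _ _ disj] card_Un_Int[of "X a" "Y b"] fin unfolding U
      by (simp add: finite_Un)
    obtain p where p: "card A = Suc p" using A 4 by (cases "card A") auto
    obtain q where q: "card B = Suc q" using B 4 by (cases "card B") auto
    have "2 \<le> Suc m \<longleftrightarrow> 1 \<le> m" "Suc m - 2 = m - 1" "Suc m - 1 = m" for m by auto
    note pq = p q this
    show ?thesis
      using U' pairing_number_rec[of p q] unfolding cX[OF a] cY[OF b] cZ cXY pq by linarith
  qed
qed

end

section \<open>From marked points to coordinates\<close>

text \<open>Coordinates for an arbitrary position of the lines: \<open>e\<close> is a direction of
  \<open>L\<close>, and \<open>n\<close> is \<open>e\<close> turned by a right angle. The inner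
  products with \<open>n\<close> and \<open>e\<close> take the places of \<open>f\<close> and
  \<open>g\<close>.\<close>

lemma card_noncrossing_pairings_marked_points:
  assumes "marked_points p q A B"
  shows "card (noncrossing_pairings (A \<union> B)) = pairing_number p q"
proof -
  from assms obtain L M where LM: "finite A" "card A = p" "finite B" "card B = q"
    "affine L" "aff_dim L = 1" "affine_parallel L M" "L \<noteq> M" "A \<subseteq> L" "B \<subseteq> M" "affine M"
    unfolding marked_points_def by blast
  obtain w where w: "M = (+) w ` L" using LM by (auto simp: affine_parallel_def)
  have "L \<noteq> {}" using LM by auto
  then obtain u where u: "u \<in> L" by auto
  obtain v where v: "v \<in> L" "v \<noteq> u"
  proof -
    have "L \<noteq> {u}" using LM by auto
    then show ?thesis using u that by auto
  qed
  define e where "e = v - u"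
  have e: "e \<noteq> 0" using v by (simp add: e_def)
  define n :: "real^2" where "n = vector [- (e$2), e$1]"
  have ne: "e$1 \<noteq> 0 \<or> e$2 \<noteq> 0" using e by (auto simp: vec_eq_iff forall_2)
  have pos: "(e$1)\<^sup>2 + (e$2)\<^sup>2 \<noteq> 0" using ne by (simp add: sum_power2_eq_zero_iff)
  \<comment> \<open>Up to sign, the determinant of this linear system is the squared length of
    \<open>e\<close>. This yields the injectivity required by \<open>two_lines\<close>.\<close>
  have *: "x = 0" if "n \<bullet> x = 0" "e \<bullet> x = 0" for x
  proof -
    have 1: "- (e$2) * x$1 + e$1 * x$2 = 0" "e$1 * x$1 + e$2 * x$2 = 0"
      using that by (simp_all add: n_def inner_vec_def sum_2)
    have "((e$1)\<^sup>2 + (e$2)\<^sup>2) * x$1 = 0" "((e$1)\<^sup>2 + (e$2)\<^sup>2) * x$2 = 0"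
      using 1 by algebra+
    then show ?thesis using pos by (auto simp: vec_eq_iff forall_2)
  qed
  have proj: "\<exists>r. x = r *\<^sub>R e" if "n \<bullet> x = 0" for x
  proof -
    have "e \<bullet> e \<noteq> 0" using e by simp
    moreover have "n \<bullet> e = 0" by (simp add: n_def inner_vec_def sum_2)
    ultimately have "x - ((e \<bullet> x) / (e \<bullet> e)) *\<^sub>R e = 0"
      using that by (intro *) (simp_all add: inner_diff_right)
    then show ?thesis by (auto simp: algebra_simps)
  qed
  have "affine hull {u, v} = L"
  proof (rule affine_dim_equal)
    show "affine hull {u, v} \<subseteq> L" using LM(5) u v by (intro hull_minimal) auto
  qed (use LM(5,6) v in auto)
  then have nL: "n \<bullet> x = n \<bullet> u" if "x \<in> L" for x
  proof -
    have "x \<in> affine hull {u, v}" using that \<open>affine hull {u, v} = L\<close> by simp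
    then obtain t where "x = u + t *\<^sub>R e" by (auto simp: affine_hull_2_alt e_def)
    moreover have "n \<bullet> e = 0" by (simp add: n_def inner_vec_def sum_2)
    ultimately show ?thesis by (simp add: inner_add_right)
  qed
  have nM: "n \<bullet> x = n \<bullet> u + n \<bullet> w" if "x \<in> M" for x
    using that nL w by (auto simp: inner_add_right)
  \<comment> \<open>A translation along the direction of \<open>L\<close> would map \<open>L\<close>
    into itself; then \<open>M \<subseteq> L\<close> with equal dimensions forces
    \<open>M = L\<close>.\<close>
  have "n \<bullet> w \<noteq> 0"
  proof
    assume "n \<bullet> w = 0"
    then obtain r where r: "w = r *\<^sub>R e" using proj by blast
    have "w + x \<in> L" if "x \<in> L" for x
      using mem_affine_3_minus[OF LM(5) that v(1) u, of r] r by (simp add: e_def add.commute)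
    then have "M \<subseteq> L" using w by auto
    moreover have "aff_dim M = aff_dim L" by (simp add: w aff_dim_translation_eq)
    ultimately show False
      using affine_dim_equal[of M L] LM \<open>L \<noteq> {}\<close> w by auto
  qed
  then interpret two_lines "\<lambda>x. n \<bullet> x" "\<lambda>x. e \<bullet> x" "n \<bullet> u" "n \<bullet> u + n \<bullet> w"
  proof (intro two_lines.intro)
    show "linear (\<lambda>x. n \<bullet> x)" "linear (\<lambda>x. e \<bullet> x)"
      by (intro bounded_linear.linear bounded_linear_inner_right)+
  next
    fix x y assume "n \<bullet> x = n \<bullet> y" "e \<bullet> x = e \<bullet> y"
    then show "x = y" using *[of "x - y"] by (simp add: inner_diff_right)
  qed auto
  show ?thesis
    using card_noncrossing_pairings[of A B] LM nL nM by (auto simp: subset_iff)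
qed

section \<open>The generating function\<close>

unbundle no vec_syntax
unbundle fps_syntax

section \<open>Binomial identities for the diagonal sum\<close>

lemma sum_choose_mult: "(\<Sum>m\<le>i. (i choose m) * (k choose m)) = (k + i) choose i"
proof -
  have "(\<Sum>m\<le>i. (k choose m) * (i choose (i - m))) = (k + i) choose i"
    by (rule vandermonde)
  moreover have "(\<Sum>m\<le>i. (i choose m) * (k choose m)) = (\<Sum>m\<le>i. (k choose m) * (i choose (i - m)))"
    by (intro sum.cong refl) (simp add: binomial_symmetric[symmetric])
  ultimately show ?thesis by simp
qed

text \<open>Both sides equal \<open>(i + k)! / (m!^2 (i - m)! (k - m)!)\<close>. The right one
  isolates the central binomial coefficient, which depends on \<open>m\<close> alone.\<close>

lemma choose_rearrange:
  assumes "m \<le> i" "m \<le> k"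
  shows "(k + i choose i) * ((i choose m) * (k choose m)) =
    (2 * m choose m) * ((i + k choose (2 * m)) * (i + k - 2 * m choose (i - m)))"
proof -
  have e: "i + k - 2 * m - (i - m) = k - m" "2 * m - m = m" using assms by auto
  have "real ((k + i choose i) * ((i choose m) * (k choose m))) =
    real ((2 * m choose m) * ((i + k choose (2 * m)) * (i + k - 2 * m choose (i - m))))"
    using assms by (simp add: binomial_fact e add.commute[of k i])
  then show ?thesis by (simp only: of_nat_eq_iff)
qed

text \<open>The inner sum is the coefficient of \<open>x\<^sup>n\<close> in \<open>x\<^bsup>3m\<^esup> / (1 - x - x\<^sup>2)\<^bsup>2m+1\<^esup>\<close>.\<close>
lemma sum_choose_square_expand:
  "(\<Sum>i\<le>n. (n - i choose i)\<^sup>2) =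
    (\<Sum>m\<le>n. (2 * m choose m) *
       (if 3 * m \<le> n then \<Sum>j\<le>n - 3 * m. (2 * m + j choose j) * (j choose (n - 3 * m - j)) else 0))"
proof -
  have inner: "(\<Sum>i\<le>n. (n - i choose i) * ((i choose m) * (n - 2 * i choose m)))
      = (2 * m choose m) * (if 3 * m \<le> n then \<Sum>j\<le>n - 3 * m. (2 * m + j choose j) * (j choose (n - 3 * m - j)) else 0)" for m
  proof -
    have "(\<Sum>i\<le>n. (n - i choose i) * ((i choose m) * (n - 2 * i choose m)))
      = (\<Sum>i\<in>{i. m \<le> i \<and> 2 * i + m \<le> n}. (n - i choose i) * ((i choose m) * (n - 2 * i choose m)))"
    proof (rule sum.mono_neutral_right)
      show "\<forall>i\<in>{..n} - {i. m \<le> i \<and> 2 * i + m \<le> n}. (n - i choose i) * ((i choose m) * (n - 2 * i choose m)) = 0"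
      proof
        fix i assume "i \<in> {..n} - {i. m \<le> i \<and> 2 * i + m \<le> n}"
        \<comment> \<open>The third alternative covers \<open>2 * i > n\<close>: there truncated
          subtraction makes \<open>n - 2 * i\<close> zero, and for \<open>m = 0\<close> only the
          first factor vanishes.\<close>
        then have "i < m \<or> n - 2 * i < m \<or> n - i < i" by auto
        then show "(n - i choose i) * ((i choose m) * (n - 2 * i choose m)) = 0"
          by (auto simp: binomial_eq_0)
      qed
    qed auto
    also have "\<dots> = (\<Sum>i\<in>{i. m \<le> i \<and> 2 * i + m \<le> n}.
        (2 * m choose m) * ((n - i choose (2 * m)) * (n - i - 2 * m choose (i - m))))"
    proof (rule sum.cong[OF refl])
      fix i assume "i \<in> {i. m \<le> i \<and> 2 * i + m \<le> n}"
      then obtain k where k: "n = k + 2 * i" "m \<le> k" "m \<le> i"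
        by (auto intro: that[of "n - 2 * i"])
      then have "n - i = k + i" "n - 2 * i = k" by auto
      then show "(n - i choose i) * ((i choose m) * (n - 2 * i choose m)) =
          (2 * m choose m) * ((n - i choose (2 * m)) * (n - i - 2 * m choose (i - m)))"
        using choose_rearrange[OF k(3,2)] by (simp add: add.commute[of i k])
    qed
    also have "\<dots> = (2 * m choose m) * (\<Sum>i\<in>{i. m \<le> i \<and> 2 * i + m \<le> n}.
        (n - i choose (2 * m)) * (n - i - 2 * m choose (i - m)))"
      by (simp add: sum_distrib_left)
    also have "(\<Sum>i\<in>{i. m \<le> i \<and> 2 * i + m \<le> n}. (n - i choose (2 * m)) * (n - i - 2 * m choose (i - m)))
      = (if 3 * m \<le> n then \<Sum>j\<le>n - 3 * m. (2 * m + j choose j) * (j choose (n - 3 * m - j)) else 0)"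
    proof (cases "3 * m \<le> n")
      case False
      then have "{i. m \<le> i \<and> 2 * i + m \<le> n} = {}" by auto
      with False show ?thesis by simp
    next
      case True
      have "(\<Sum>j\<le>n - 3 * m. (2 * m + j choose j) * (j choose (n - 3 * m - j)))
        = (\<Sum>j\<in>{j. j \<le> n - 3 * m \<and> n - 3 * m \<le> 2 * j}. (2 * m + j choose j) * (j choose (n - 3 * m - j)))"
        by (rule sum.mono_neutral_right) (auto simp: binomial_eq_0)
      also have "\<dots> = (\<Sum>i\<in>{i. m \<le> i \<and> 2 * i + m \<le> n}. (n - i choose (2 * m)) * (n - i - 2 * m choose (i - m)))"
      proof (rule sum.reindex_bij_witness[of _ "\<lambda>i. n - i - 2 * m" "\<lambda>j. n - j - 2 * m"], goal_cases)
        case (5 j)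
        then have "n - (n - j - 2 * m) = 2 * m + j" "n - j - 2 * m - m = n - 3 * m - j"
          using True by auto
        moreover have "(2 * m + j choose j) = (2 * m + j choose (2 * m))"
          by (subst binomial_symmetric) auto
        ultimately show ?case by simp
      qed (use True in auto)
      finally show ?thesis using True by simp
    qed
    finally show ?thesis .
  qed
  \<comment> \<open>One of the two equal factors is expanded by \<open>sum_choose_mult\<close>, the
    other is kept; exchanging the sums then leaves \<open>inner\<close>.\<close>
  have "(\<Sum>i\<le>n. (n - i choose i)\<^sup>2)
      = (\<Sum>i\<le>n. \<Sum>m\<le>n. (n - i choose i) * ((i choose m) * (n - 2 * i choose m)))"
  proof (rule sum.cong[OF refl])
    fix i assume i: "i \<in> {..n}"
    show "(n - i choose i)\<^sup>2 = (\<Sum>m\<le>n. (n - i choose i) * ((i choose m) * (n - 2 * i choose m)))"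
    proof (cases "2 * i \<le> n")
      case True
      have "(\<Sum>m\<le>n. (i choose m) * (n - 2 * i choose m)) = (\<Sum>m\<le>i. (i choose m) * (n - 2 * i choose m))"
        by (rule sum.mono_neutral_right) (use i in \<open>auto simp: binomial_eq_0\<close>)
      also have "\<dots> = (n - i choose i)"
        unfolding sum_choose_mult using True by (simp add: numeral_2_eq_2)
      finally show ?thesis by (simp add: sum_distrib_left[symmetric] power2_eq_square)
    qed (simp add: binomial_eq_0)
  qed
  also have "\<dots> = (\<Sum>m\<le>n. \<Sum>i\<le>n. (n - i choose i) * ((i choose m) * (n - 2 * i choose m)))"
    by (rule sum.swap)
  finally show ?thesis by (simp add: inner)
qed

section \<open>Power series for the inverse square root\<close>

text \<open>The coefficients of \<open>1 - x\<close> to the power -1/2; dividing by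
  \<open>4 ^ n\<close> moves the singularity to 1.\<close>

definition cbin :: "nat \<Rightarrow> real" where
  "cbin n = of_nat (2 * n choose n) / 4 ^ n"

lemma cbin_0 [simp]: "cbin 0 = 1"
  by (simp add: cbin_def)

lemma cbin_Suc: "cbin (Suc n) = cbin n * ((2 * real n + 1) / (2 * real n + 2))"
proof -
  have "real (2 * m choose m) = fact (2 * m) / (fact m * fact m)" for m
    by (subst binomial_fact) (simp_all add: mult_2)
  then have *: "cbin m = fact (2 * m) / (fact m * fact m) / 4 ^ m" for m
    by (simp add: cbin_def)
  have "2 * Suc n = Suc (Suc (2 * n))" by simp
  then have "fact (2 * Suc n) = (2 * real n + 2) * (2 * real n + 1) * fact (2 * n)"
    by (simp only: fact_Suc) (simp add: algebra_simps)
  then show ?thesis unfolding * by (simp add: divide_simps) (simp add: algebra_simps)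
qed

lemma cbin_gbinomial: "cbin n = (- 1) ^ n * (- (1 / 2) gchoose n)"
proof (induction n)
  case (Suc n)
  have "of_nat (Suc n) * (- (1 / 2) gchoose Suc n) = (- (1 / 2) - real n) * (- (1 / 2) gchoose n)"
    using gbinomial_absorb_comp[of "- (1/2) :: real" n] gbinomial_absorption[of n "- (1/2) :: real"]
      by (simp add: gbinomial_mult_1)
  then have "(- (1 / 2) gchoose Suc n) = (- (1 / 2) - real n) / (real n + 1) * (- (1 / 2) gchoose n)"
    by (simp add: field_simps)
  then show ?case using Suc by (simp add: cbin_Suc) (simp add: field_simps)
qed simp

definition inv_sqrt_fps :: "real fps" where
  "inv_sqrt_fps = Abs_fps cbin"

text \<open>Vandermonde for the exponent -1/2 taken twice gives the exponent -1, hence the geometric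
  series.\<close>

lemma inv_sqrt_fps_square: "inv_sqrt_fps\<^sup>2 * (1 - fps_X) = 1"
proof -
  have "inv_sqrt_fps\<^sup>2 = Abs_fps (\<lambda>_. 1)"
  proof (rule fps_ext)
    fix n
    have "inv_sqrt_fps\<^sup>2 $ n = (\<Sum>k=0..n. cbin k * cbin (n - k))"
      by (simp add: power2_eq_square fps_mult_nth inv_sqrt_fps_def)
    also have "\<dots> = (\<Sum>k=0..n. (- 1) ^ n * ((- (1 / 2) gchoose k) * (- (1 / 2) gchoose (n - k))))"
    proof (intro sum.cong refl)
      fix k assume "k \<in> {0..n}"
      then have "(- 1) ^ n = (- 1 :: real) ^ k * (- 1) ^ (n - k)" by (simp flip: power_add)
      then show "cbin k * cbin (n - k) = (- 1) ^ n * ((- (1 / 2) gchoose k) * (- (1 / 2) gchoose (n - k)))"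
        by (simp add: cbin_gbinomial)
    qed
    also have "\<dots> = (- 1) ^ n * (- 1 gchoose n)"
      using gbinomial_Vandermonde[of "- (1 / 2)" "- (1 / 2) :: real" n]
      by (simp add: sum_distrib_left[symmetric])
    also have "(- 1 gchoose n :: real) = (- 1) ^ n"
      by (simp add: gbinomial_minus flip: binomial_gbinomial)
    finally show "inv_sqrt_fps\<^sup>2 $ n = Abs_fps (\<lambda>_. 1) $ n"
      by (simp flip: power_mult_distrib)
  qed
  then show ?thesis by (intro fps_ext) (simp add: right_diff_distrib)
qed


lemma inv_sqrt_fps_compose_square:
  assumes "u $ 0 = 0"
  shows "(inv_sqrt_fps oo u)\<^sup>2 * (1 - u) = 1"
proof -
  have "(inv_sqrt_fps\<^sup>2 * (1 - fps_X)) oo u = 1"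
    by (simp add: inv_sqrt_fps_square)
  with assms show ?thesis
    by (simp add: fps_compose_mult_distrib fps_compose_power[symmetric] fps_compose_sub_distrib)
qed

text \<open>As \<open>u\<close> has no constant term, \<open>u ^ m\<close> has no terms below degree
  \<open>m\<close>, so the inner sum extends to a range independent of \<open>j\<close> and the sums
  can be exchanged.\<close>

lemma fps_compose_mult_nth:
  fixes f u v :: "'a::idom fps"
  assumes "u $ 0 = 0"
  shows "((f oo u) * v) $ n = (\<Sum>m\<le>n. f $ m * (u ^ m * v) $ n)"
proof -
  have "((f oo u) * v) $ n = (\<Sum>j\<le>n. (\<Sum>m\<le>n. f $ m * u ^ m $ j) * v $ (n - j))"
    unfolding fps_mult_nth fps_compose_nth atLeast0AtMost
  proof (rule sum.cong[OF refl])
    fix j assume "j \<in> {..n}"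
    then have "(\<Sum>m\<le>j. f $ m * u ^ m $ j) = (\<Sum>m\<le>n. f $ m * u ^ m $ j)"
      using startsby_zero_power_prefix[OF assms] by (intro sum.mono_neutral_left) auto
    then show "(\<Sum>m\<le>j. f $ m * u ^ m $ j) * v $ (n - j) = (\<Sum>m\<le>n. f $ m * u ^ m $ j) * v $ (n - j)"
      by simp
  qed
  also have "\<dots> = (\<Sum>m\<le>n. f $ m * (\<Sum>j\<le>n. u ^ m $ j * v $ (n - j)))"
    by (subst sum_distrib_right, subst sum.swap) (simp add: sum_distrib_left mult.assoc)
  finally show ?thesis by (simp add: fps_mult_nth atLeast0AtMost)
qed

text \<open>Substitutes \<open>x + x^2\<close> into the negative binomial series; the coefficient of
  \<open>x^l\<close> in \<open>x^j (1 + x)^j\<close> is \<open>j choose (l - j)\<close>.\<close>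

lemma fps_nth_inverse_fib_power:
  "inverse ((1 - (fps_X + fps_X\<^sup>2)) ^ Suc N) $ l
     = (\<Sum>j\<le>l. of_nat ((N + j choose j) * (j choose (l - j))) :: real)"
proof -
  let ?s = "fps_X + fps_X\<^sup>2 :: real fps"
  have "inverse ((1 - ?s) ^ Suc N) = inverse ((1 - fps_X) ^ Suc N) oo ?s"
    by (subst fps_inverse_compose)
      (simp_all add: fps_compose_power[symmetric] fps_compose_sub_distrib del: power_Suc)
  also have "inverse ((1 - fps_X) ^ Suc N) = Abs_fps (\<lambda>k. of_nat (N + k choose k) :: real)"
    using one_minus_const_fps_X_neg_power'[of "Suc N" "1 :: real"] by (simp del: power_Suc)
  finally have "inverse ((1 - ?s) ^ Suc N) $ l = (\<Sum>j\<le>l. of_nat (N + j choose j) * ?s ^ j $ l)"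
    by (simp add: fps_compose_nth atLeast0AtMost del: power_Suc)
  also have "\<dots> = (\<Sum>j\<le>l. of_nat (N + j choose j) * of_nat (j choose (l - j)))"
  proof (intro sum.cong refl)
    fix j assume "j \<in> {..l}"
    have "?s = fps_X * (1 + fps_X)" by (simp add: distrib_left power2_eq_square)
    then have "?s ^ j = fps_X ^ j * (1 + fps_X) ^ j" by (simp only: power_mult_distrib)
    then have "?s ^ j $ l = (1 + fps_X) ^ j $ (l - j)"
      using \<open>j \<in> {..l}\<close> by (simp only: fps_X_power_mult_nth) simp
    then show "of_nat (N + j choose j) * ?s ^ j $ l = of_nat (N + j choose j) * (of_nat (j choose (l - j)) :: real)"
      by (simp add: fps_binomial_of_nat[symmetric] binomial_gbinomial)
  qed
  finally show ?thesis by simp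
qed

definition pairing_fps :: "real fps" where
  "pairing_fps = Abs_fps (\<lambda>n. of_nat (\<Sum>i\<le>n. (n - i choose i)\<^sup>2))"

text \<open>With \<open>v = 1 / (1 - x - x^2)\<close> and \<open>w = x^3 v^2\<close>,
  \<open>sum_choose_square_expand\<close> says that the series is \<open>v\<close> times
  \<open>1 - 4 w\<close> to the power -1/2. Squaring removes the root, and
  \<open>(1 - x - x^2)^2 (1 - 4 w)\<close> is the quartic.\<close>

lemma pairing_fps_square:
  "pairing_fps\<^sup>2 * ((1 - (fps_X + fps_X\<^sup>2))\<^sup>2 - 4 * fps_X ^ 3) = 1"
proof -
  let ?s = "fps_X + fps_X\<^sup>2 :: real fps"
  define v where "v = inverse (1 - ?s)"
  have v: "v * (1 - ?s) = 1" unfolding v_def by (rule inverse_mult_eq_1) simp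
  define w where "w = fps_X ^ 3 * v\<^sup>2"
  have w0: "w $ 0 = 0" "(fps_const 4 * w) $ 0 = 0" by (simp_all add: w_def)
  have "pairing_fps = (inv_sqrt_fps oo (fps_const 4 * w)) * v"
  proof (rule fps_ext)
    fix n
    have "((inv_sqrt_fps oo (fps_const 4 * w)) * v) $ n
       = (\<Sum>m\<le>n. cbin m * ((fps_const 4 * w) ^ m * v) $ n)"
      by (subst fps_compose_mult_nth[OF w0(2)]) (simp add: inv_sqrt_fps_def)
    also have "\<dots> = (\<Sum>m\<le>n. of_nat ((2 * m choose m) *
       (if 3 * m \<le> n then \<Sum>j\<le>n - 3 * m. (2 * m + j choose j) * (j choose (n - 3 * m - j)) else 0)))"
    proof (intro sum.cong refl)
      fix m
      have "(fps_const 4 * w) ^ m * v = fps_const (4 ^ m) * (fps_X ^ (3 * m) * v ^ Suc (2 * m))"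
        by (simp only: w_def power_mult_distrib power_mult[symmetric] fps_const_power power_Suc mult_ac)
      also have "v ^ Suc (2 * m) = inverse ((1 - ?s) ^ Suc (2 * m))"
        unfolding v_def by (rule fps_inverse_power[symmetric])
      finally have "cbin m * ((fps_const 4 * w) ^ m * v) $ n
        = of_nat (2 * m choose m) * (fps_X ^ (3 * m) * inverse ((1 - ?s) ^ Suc (2 * m))) $ n"
        by (simp add: cbin_def del: power_Suc)
      also have "\<dots> = of_nat ((2 * m choose m) *
       (if 3 * m \<le> n then \<Sum>j\<le>n - 3 * m. (2 * m + j choose j) * (j choose (n - 3 * m - j)) else 0))"
        by (simp only: fps_X_power_mult_nth fps_nth_inverse_fib_power) simp
      finally show "cbin m * ((fps_const 4 * w) ^ m * v) $ n = of_nat ((2 * m choose m) *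
       (if 3 * m \<le> n then \<Sum>j\<le>n - 3 * m. (2 * m + j choose j) * (j choose (n - 3 * m - j)) else 0))" .
    qed
    also have "\<dots> = pairing_fps $ n"
      by (simp only: pairing_fps_def fps_nth_Abs_fps sum_choose_square_expand of_nat_sum)
    finally show "pairing_fps $ n = ((inv_sqrt_fps oo (fps_const 4 * w)) * v) $ n" ..
  qed note F = this
  have P: "(1 - ?s)\<^sup>2 - 4 * fps_X ^ 3 = (1 - ?s)\<^sup>2 * (1 - fps_const 4 * w)"
  proof -
    have "(1 - ?s)\<^sup>2 * (1 - 4 * (fps_X ^ 3 * v\<^sup>2)) = (1 - ?s)\<^sup>2 - 4 * fps_X ^ 3 * (v * (1 - ?s))\<^sup>2"
      by (simp only: power_mult_distrib) (simp add: algebra_simps)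
    then show ?thesis by (simp add: v w_def numeral_fps_const)
  qed
  have "pairing_fps\<^sup>2 * ((1 - ?s)\<^sup>2 - 4 * fps_X ^ 3)
     = ((inv_sqrt_fps oo (fps_const 4 * w))\<^sup>2 * (1 - fps_const 4 * w)) * (v * (1 - ?s))\<^sup>2"
    unfolding F P by (simp only: power_mult_distrib mult_ac)
  also have "\<dots> = 1"
    using inv_sqrt_fps_compose_square[OF w0(2)] v by simp
  finally show ?thesis .
qed

section \<open>Coefficient asymptotics\<close>

lemma cbin_pos: "0 < cbin n"
  by (simp add: cbin_def)

lemma cbin_Suc_square: "(cbin (Suc n))\<^sup>2 = (cbin n)\<^sup>2 * ((2 * real n + 1) / (2 * real n + 2))\<^sup>2"
  by (simp only: cbin_Suc power_mult_distrib)

text \<open>The induction rests on \<open>4 (n + 1)^2 - 1 = (2 n + 1) (2 n + 3)\<close>. Thus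
  \<open>(cbin n)^2 (2 n + 1)\<close> is the reciprocal of a partial Wallis product.\<close>

lemma cbin_wallis: "(cbin n)\<^sup>2 * (2 * real n + 1) * (\<Prod>k=1..n. (4 * real k ^ 2) / (4 * real k ^ 2 - 1)) = 1"
proof (induction n)
  case (Suc n)
  have "4 * real (Suc n) ^ 2 - 1 = (2 * real n + 1) * (2 * real n + 3)"
    by (simp add: power2_eq_square algebra_simps)
  then have step: "(cbin (Suc n))\<^sup>2 * (2 * real (Suc n) + 1) * ((4 * real (Suc n) ^ 2) / (4 * real (Suc n) ^ 2 - 1))
      = (cbin n)\<^sup>2 * (2 * real n + 1)"
    by (simp only:) (simp add: cbin_Suc power_divide divide_simps, simp add: power2_eq_square algebra_simps)
  have prod: "(\<Prod>k=1..Suc n. h k) = h (Suc n) * (\<Prod>k=1..n. h k)" for h :: "nat \<Rightarrow> real" by simp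
  show ?case unfolding prod mult.assoc[symmetric] step by (rule Suc)
qed simp

lemma cbin_square_lim: "(\<lambda>n. (cbin n)\<^sup>2 * (2 * real n + 1)) \<longlonglongrightarrow> 2 / pi"
proof -
  let ?W = "\<lambda>n. \<Prod>k=1..n. (4 * real k ^ 2) / (4 * real k ^ 2 - 1)"
  have "(cbin n)\<^sup>2 * (2 * real n + 1) = inverse (?W n)" for n
    by (rule inverse_unique[symmetric], subst mult.commute, rule cbin_wallis)
  moreover have "(\<lambda>n. inverse (?W n)) \<longlonglongrightarrow> inverse (pi / 2)"
    by (intro tendsto_inverse wallis) simp
  ultimately show ?thesis by simp
qed

text \<open>A decreasing sequence stays above its limit; consecutive terms have ratio
  \<open>(2 n + 1) (2 n + 3) / (2 n + 2)^2\<close>, which is below 1.\<close>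

lemma cbin_square_ge: "2 / pi \<le> (cbin n)\<^sup>2 * (2 * real n + 1)"
proof (rule decseq_ge[OF _ cbin_square_lim], rule decseq_SucI)
  fix n
  have "(2 * real n + 1) * (2 * real n + 3) \<le> (2 * real n + 2)\<^sup>2"
    by (simp add: power2_eq_square algebra_simps)
  then have "(2 * real n + 1) * (2 * real n + 3) / (2 * real n + 2)\<^sup>2 \<le> 1"
    by (subst divide_le_eq_1_pos) simp_all
  then have "(cbin n)\<^sup>2 * (2 * real n + 1) * ((2 * real n + 1) * (2 * real n + 3) / (2 * real n + 2)\<^sup>2)
    \<le> (cbin n)\<^sup>2 * (2 * real n + 1)"
    by (intro mult_left_le) simp_all
  then show "(cbin (Suc n))\<^sup>2 * (2 * real (Suc n) + 1) \<le> (cbin n)\<^sup>2 * (2 * real n + 1)"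
    by (simp add: cbin_Suc power_mult_distrib power_divide) (simp add: power2_eq_square mult_ac add_ac)
qed

text \<open>Companion of the lower bound: with \<open>2 n\<close> in place of \<open>2 n + 1\<close>
  the sequence increases to the same limit.\<close>

lemma cbin_square_le: "(cbin n)\<^sup>2 * (2 * real n) \<le> 2 / pi"
proof (rule incseq_le)
  show "incseq (\<lambda>n. (cbin n)\<^sup>2 * (2 * real n))"
  proof (rule incseq_SucI)
    fix n
    have "real n * (2 * real n + 2)\<^sup>2 \<le> (real n + 1) * (2 * real n + 1)\<^sup>2"
      by (simp add: power2_eq_square algebra_simps)
    then have "2 * real n \<le> ((2 * real n + 1) / (2 * real n + 2))\<^sup>2 * (2 * (real n + 1))"
      by (simp add: power_divide divide_simps) (simp add: power2_eq_square algebra_simps)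
    then have "(cbin n)\<^sup>2 * (2 * real n) \<le> (cbin n)\<^sup>2 * (((2 * real n + 1) / (2 * real n + 2))\<^sup>2 * (2 * (real n + 1)))"
      by (rule mult_left_mono) simp
    then show "(cbin n)\<^sup>2 * (2 * real n) \<le> (cbin (Suc n))\<^sup>2 * (2 * real (Suc n))"
      by (simp add: cbin_Suc_square mult_ac add_ac)
  qed
  have "(\<lambda>n. (cbin n)\<^sup>2 * (2 * real n + 1) * (2 * real n / (2 * real n + 1))) \<longlonglongrightarrow> 2 / pi * 1"
    by (intro tendsto_mult cbin_square_lim) real_asymp
  moreover have "(cbin n)\<^sup>2 * (2 * real n + 1) * (2 * real n / (2 * real n + 1)) = (cbin n)\<^sup>2 * (2 * real n)" for n
  proof -
    have "2 * real n + 1 \<noteq> 0" by linarith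
    then show ?thesis by simp
  qed
  ultimately show "(\<lambda>n. (cbin n)\<^sup>2 * (2 * real n)) \<longlonglongrightarrow> 2 / pi" by simp
qed

text \<open>Put \<open>s = 1 / sqrt (pi n)\<close>. The two bounds give
  \<open>s^2 - (cbin n)^2 \<le> s^2 / n\<close>, and dividing by \<open>s + cbin n \<ge> s\<close>
  leaves an error of at most \<open>s / n\<close>.\<close>

lemma cbin_asymp:
  assumes "n \<ge> 1"
  shows "\<bar>cbin n - 1 / sqrt (pi * real n)\<bar> \<le> real n powr (- (3 / 2))"
proof -
  define s where "s = 1 / sqrt (pi * real n)"
  have n: "real n > 0" using assms by simp
  have s: "s > 0" "s\<^sup>2 = 1 / (pi * n)" using n by (simp_all add: s_def power_divide)
  have u: "(cbin n)\<^sup>2 \<le> s\<^sup>2" using cbin_square_le[of n] n by (simp add: s field_simps)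
  then have le: "cbin n \<le> s" by (rule power2_le_imp_le) (use s in simp)
  have l: "2 / (pi * (2 * real n + 1)) \<le> (cbin n)\<^sup>2" 
    using cbin_square_ge[of n] pos_divide_le_eq[of "2 * real n + 1" "2 / pi" "(cbin n)\<^sup>2"] by simp
  have "(s - cbin n) * s \<le> (s - cbin n) * (s + cbin n)"
    using le cbin_pos[of n] by (intro mult_left_mono) auto
  also have "\<dots> = s\<^sup>2 - (cbin n)\<^sup>2" by (simp add: power2_eq_square algebra_simps)
  also have "\<dots> \<le> 1 / (pi * n) - 2 / (pi * (2 * real n + 1))" using l s by simp
  also have "\<dots> = s\<^sup>2 * (1 / (2 * real n + 1))"
  proof -
    have "1 / (pi * n) - 2 / (pi * m) = (m - 2 * n) / (pi * n * m)" if "m > 0" for m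
      using n that by (simp add: field_simps)
    from this[of "2 * real n + 1"] show ?thesis by (simp add: s)
  qed
  also have "\<dots> \<le> s\<^sup>2 * (1 / n)" using n by (intro mult_left_mono) (auto simp: field_simps)
  finally have "(s - cbin n) * s \<le> (s / n) * s" by (simp add: power2_eq_square)
  then have "s - cbin n \<le> s / n" using s by (simp only: mult_le_cancel_right_pos)
  also have "\<dots> \<le> (1 / sqrt n) / n"
  proof -
    have "sqrt n \<le> sqrt (pi * n)" using n pi_ge_two by simp
    then have "s \<le> 1 / sqrt n" unfolding s_def using n by (intro divide_left_mono) auto
    then show ?thesis using n by (intro divide_right_mono) auto
  qed
  also have "\<dots> = real n powr (- (3 / 2))"
  proof -
    have "real n powr (- (3 / 2)) = real n powr (- (1 / 2) - 1)" by simp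
    also have "\<dots> = real n powr (- (1 / 2)) / n" using n by (subst powr_diff) simp
    also have "\<dots> = (1 / sqrt n) / n" using n by (simp add: powr_minus powr_half_sqrt inverse_eq_divide)
    finally show ?thesis ..
  qed
  finally show ?thesis using le by (simp add: s_def)
qed

text \<open>The quantity \<open>(cbin n)^2 (n + 1)\<close> is nonincreasing and starts at 1.\<close>

lemma cbin_le: "cbin n \<le> (real n + 1) powr (- (1 / 2))"
proof -
  have "(cbin n)\<^sup>2 * (real n + 1) \<le> 1"
  proof (induction n)
    case (Suc n)
    have "(2 * real n + 1)\<^sup>2 * (real n + 2) \<le> (2 * real n + 2)\<^sup>2 * (real n + 1)"
      by (simp add: power2_eq_square algebra_simps)
    then have "((2 * real n + 1) / (2 * real n + 2))\<^sup>2 * (real n + 2) \<le> real n + 1"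
      by (simp add: power_divide divide_simps) (simp add: power2_eq_square algebra_simps)
    then have "(cbin n)\<^sup>2 * (((2 * real n + 1) / (2 * real n + 2))\<^sup>2 * (real n + 2)) \<le> (cbin n)\<^sup>2 * (real n + 1)"
      by (rule mult_left_mono) simp
    with Suc show ?case by (simp add: cbin_Suc_square mult_ac add_ac)
  qed simp
  then have "(cbin n)\<^sup>2 \<le> (1 / sqrt (real n + 1))\<^sup>2" by (simp add: power_divide field_simps)
  then have "cbin n \<le> 1 / sqrt (real n + 1)" by (rule power2_le_imp_le) simp
  then show ?thesis by (simp add: powr_minus powr_half_sqrt field_simps)
qed

lemma cbin_le_1: "cbin n \<le> 1"
  using cbin_le[of n] powr_mono[of "- (1/2)" 0 "real n + 1"] by simp

lemma cbin_diff_Suc: "0 \<le> cbin n - cbin (Suc n)" "cbin n - cbin (Suc n) \<le> (real n + 1) powr (- (3 / 2))"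
proof -
  have e: "cbin n - cbin (Suc n) = cbin n / (2 * real n + 2)"
    by (simp add: cbin_Suc field_simps)
  show "0 \<le> cbin n - cbin (Suc n)" unfolding e using cbin_pos[of n] by simp
  have "cbin n / (2 * real n + 2) \<le> cbin n / (real n + 1)"
    using cbin_pos[of n] by (intro divide_left_mono) auto
  also have "\<dots> \<le> (real n + 1) powr (- (1 / 2)) / (real n + 1)"
    by (intro divide_right_mono cbin_le) simp
  also have "\<dots> = (real n + 1) powr (- (1 / 2) - 1)" by (subst powr_diff) simp
  finally have "cbin n / (2 * real n + 2) \<le> (real n + 1) powr (- (1 / 2) - 1)" .
  then show "cbin n - cbin (Suc n) \<le> (real n + 1) powr (- (3 / 2))" unfolding e by simp
qed

lemma cbin_diff:
  "0 \<le> cbin m - cbin (m + k)" "cbin m - cbin (m + k) \<le> real k * (real m + 1) powr (- (3 / 2))"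
proof (induction k)
  case (Suc k)
  { case 1 then show ?case using Suc(1) cbin_diff_Suc(1)[of "m + k"] by simp }
  { case 2
    have "(real (m + k) + 1) powr (- (3 / 2)) \<le> (real m + 1) powr (- (3 / 2))"
      by (rule powr_mono2') auto
    then show ?case using Suc(2) cbin_diff_Suc(2)[of "m + k"] by (simp add: algebra_simps) }
qed auto

text \<open>Uses \<open>m + k + 1 \<le> (m + 1) (k + 1)\<close> to trade the small index for the large one.\<close>
lemma cbin_shift_bound:
  "\<bar>(if k \<le> n then cbin (n - k) else 0) - cbin n\<bar> \<le> (real k + 1) ^ 3 * (real n + 1) powr (- (3 / 2))"
proof (cases "k \<le> n")
  case True
  then obtain m where m: "n = m + k" by (metis add.commute le_iff_add)
  let ?x = "real m + 1" and ?y = "real k + 1" and ?z = "real n + 1"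
  have "?z \<le> ?x * ?y" by (simp add: m algebra_simps)
  then have "(?x * ?y) powr (- (3 / 2)) \<le> ?z powr (- (3 / 2))" by (intro powr_mono2') auto
  then have "?x powr (- (3 / 2)) * (?y powr (- (3 / 2)) * ?y powr (3 / 2)) \<le> ?z powr (- (3 / 2)) * ?y powr (3 / 2)"
    by (simp add: powr_mult)
  also have "?y powr (- (3 / 2)) * ?y powr (3 / 2) = 1" by (simp flip: powr_add)
  \<comment> \<open>Rounding the exponent 3/2 up to 2 here, and \<open>k\<close> up to
    \<open>k + 1\<close> below, produces the cube in the bound.\<close>
  also have "?z powr (- (3 / 2)) * ?y powr (3 / 2) \<le> ?z powr (- (3 / 2)) * ?y powr 2"
    by (intro mult_left_mono powr_mono) auto
  finally have "?x powr (- (3 / 2)) \<le> ?z powr (- (3 / 2)) * ?y ^ 2" by simp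
  then have "real k * ?x powr (- (3 / 2)) \<le> ?y * (?z powr (- (3 / 2)) * ?y ^ 2)"
    by (intro mult_mono) auto
  with cbin_diff[of m k] show ?thesis by (simp add: m power3_eq_cube power2_eq_square mult_ac)
next
  case False
  \<comment> \<open>For \<open>k > n\<close> the difference is \<open>cbin n\<close> in absolute
    value, which is at most 1; the exponent \<open>3 / 2\<close> is written \<open>3 - 3 / 2\<close>
    to exhibit the required product.\<close>
  have "cbin n * 1 \<le> 1 * (real n + 1) powr (3 - 3 / 2)"
    using cbin_le_1[of n] by (intro mult_mono ge_one_powr_ge_zero) auto
  also have "\<dots> = (real n + 1) ^ 3 * (real n + 1) powr (- (3 / 2))"
    by (subst powr_diff) (simp add: powr_minus field_simps)
  also have "\<dots> \<le> (real k + 1) ^ 3 * (real n + 1) powr (- (3 / 2))"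
    using False by (intro mult_right_mono power_mono) auto
  finally show ?thesis using False cbin_pos[of n] by simp
qed

section \<open>Convolution with a rapidly decaying sequence\<close>

text \<open>Extending the finite sum by zeros turns the difference into one series, whose terms are
  bounded by \<open>cbin_shift_bound\<close>; the cubic weight comes from there.\<close>

lemma cbin_convolution:
  assumes w: "summable (\<lambda>k. (real k + 1) ^ 3 * \<bar>w k\<bar>)"
  shows "\<bar>(\<Sum>k\<le>n. cbin (n - k) * w k) - cbin n * (\<Sum>k. w k)\<bar>
           \<le> (\<Sum>k. (real k + 1) ^ 3 * \<bar>w k\<bar>) * (real n + 1) powr (- (3 / 2))"
proof -
  have w': "summable w"
  proof (rule summable_comparison_test[OF _ w], intro exI allI impI)
    fix k
    have "1 * \<bar>w k\<bar> \<le> (real k + 1) ^ 3 * \<bar>w k\<bar>" by (intro mult_right_mono) (auto intro: one_le_power)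
    then show "norm (w k) \<le> (real k + 1) ^ 3 * \<bar>w k\<bar>" by simp
  qed
  let ?d = "\<lambda>k. (if k \<le> n then cbin (n - k) else 0)"
  let ?K = "(real n + 1) powr (- (3 / 2))"
  have "(\<lambda>k. if k \<in> {..n} then cbin (n - k) * w k else 0) sums (\<Sum>k\<in>{..n}. cbin (n - k) * w k)"
    by (rule sums_If_finite_set) simp
  also have "(\<lambda>k. if k \<in> {..n} then cbin (n - k) * w k else 0) = (\<lambda>k. ?d k * w k)" by auto
  finally have "(\<lambda>k. ?d k * w k - cbin n * w k) sums ((\<Sum>k\<le>n. cbin (n - k) * w k) - cbin n * (\<Sum>k. w k))"
    by (intro sums_diff sums_mult summable_sums w')
  then have s: "(\<Sum>k\<le>n. cbin (n - k) * w k) - cbin n * (\<Sum>k. w k) = (\<Sum>k. (?d k - cbin n) * w k)"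
    by (simp add: sums_iff left_diff_distrib)
  have b: "norm ((?d k - cbin n) * w k) \<le> (real k + 1) ^ 3 * \<bar>w k\<bar> * ?K" for k
    using mult_right_mono[OF cbin_shift_bound[of k n], of "\<bar>w k\<bar>"] by (simp add: abs_mult mult_ac)
  have "norm (\<Sum>k. (?d k - cbin n) * w k) \<le> (\<Sum>k. (real k + 1) ^ 3 * \<bar>w k\<bar> * ?K)"
    by (intro norm_suminf_le b summable_mult2 w)
  also have "\<dots> = (\<Sum>k. (real k + 1) ^ 3 * \<bar>w k\<bar>) * ?K" by (rule suminf_mult2[OF w, symmetric])
  finally show ?thesis by (simp add: s)
qed

text \<open>For \<open>y\<close> between \<open>z\<close> and 1 the series converges absolutely at
  \<open>y\<close>, and \<open>(z / y)^k\<close> keeps the cubic weight bounded.\<close>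

lemma summable_cube_times_fps:
  fixes f :: "real fps"
  assumes "0 < z" "z < 1" "fps_conv_radius f \<ge> 1"
  shows "summable (\<lambda>k. (real k + 1) ^ 3 * \<bar>f $ k * z ^ k\<bar>)"
proof -
  obtain y where y: "z < y" "y < 1" using assms dense by blast
  define q where "q = z / y"
  have q: "0 < q" "q < 1" using y assms by (auto simp: q_def)
  have "(\<lambda>k. (real k + 1) ^ 3 * q ^ k) \<longlonglongrightarrow> 0" using q by real_asymp
  then have "Bseq (\<lambda>k. (real k + 1) ^ 3 * q ^ k)" by (intro convergent_imp_Bseq convergentI)
  then obtain C where C: "\<And>k. norm ((real k + 1) ^ 3 * q ^ k) \<le> C" by (auto simp: Bseq_def)
  have "ereal (norm y) < 1" using y assms by simp
  then have "summable (\<lambda>k. norm (f $ k * y ^ k))"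
    using assms(3) by (intro norm_summable_fps) (meson less_le_trans)
  then have "summable (\<lambda>k. C * norm (f $ k * y ^ k))" by (rule summable_mult)
  then show ?thesis
  proof (rule summable_comparison_test[rotated], intro exI allI impI)
    fix k
    have "z ^ k = q ^ k * y ^ k" using y assms by (simp add: q_def power_divide)
    then have "norm ((real k + 1) ^ 3 * \<bar>f $ k * z ^ k\<bar>) = norm ((real k + 1) ^ 3 * q ^ k) * norm (f $ k * y ^ k)"
      by (simp add: abs_mult)
    also have "\<dots> \<le> C * norm (f $ k * y ^ k)" by (intro mult_right_mono C) auto
    finally show "norm ((real k + 1) ^ 3 * \<bar>f $ k * z ^ k\<bar>) \<le> C * norm (f $ k * y ^ k)" .
  qed
qed

lemma fps_conv_radius_ge_1:
  fixes f :: "real fps"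
  assumes "\<And>k. \<bar>f $ k\<bar> \<le> 1"
  shows "fps_conv_radius f \<ge> 1"
proof -
  have "conv_radius (fps_nth f) \<ge> 1"
  proof (rule conv_radius_geI_ex')
    fix r :: real assume r: "0 < r" "ereal r < 1"
    show "summable (\<lambda>n. f $ n * of_real r ^ n)"
    proof (rule summable_comparison_test[OF _ summable_geometric[of r]], intro exI allI impI)
      fix n
      have "\<bar>f $ n\<bar> * r ^ n \<le> 1 * r ^ n" using r assms by (intro mult_right_mono) auto
      then show "norm (f $ n * of_real r ^ n) \<le> r ^ n" using r by (simp add: abs_mult)
    qed (use r in auto)
  qed
  then show ?thesis by (simp add: fps_conv_radius_def)
qed

text \<open>Supplies the sign when the value of the second factor is recovered from its
  square.\<close>

lemma eval_fps_pos:
  fixes f :: "real fps"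
  assumes "\<And>k. 0 \<le> f $ k" "f $ 0 = 1" "fps_conv_radius f \<ge> 1" "0 < z" "z < 1"
  shows "eval_fps f z > 0"
proof -
  have "ereal (norm z) < fps_conv_radius f" using assms(3-5) by (auto intro: less_le_trans[of _ 1])
  then have "summable (\<lambda>k. f $ k * z ^ k)" by (rule summable_fps)
  then show ?thesis unfolding eval_fps_def
    using assms by (intro suminf_pos2[of _ 0]) auto
qed

lemma inv_sqrt_fps_compose_linear_nth: "(inv_sqrt_fps oo (fps_const c * fps_X)) $ n = c ^ n * cbin n"
  by (simp add: inv_sqrt_fps_def)

section \<open>Splitting off the dominant singularity\<close>

text \<open>The hypotheses say \<open>(1 - A x) (1 - B x) = 1 - 3 x + x^2\<close>. Working in a
  commutative ring lets \<open>A\<close>, \<open>B\<close> and \<open>x\<close> be formal power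
  series.\<close>

lemma quartic_factor:
  fixes A B x :: "'a::comm_ring_1"
  assumes "A + B = 3" "A * B = 1"
  shows "(1 - (x + x\<^sup>2))\<^sup>2 - 4 * x ^ 3 = (1 - A * x) * ((1 - B * x) * (1 + x + x\<^sup>2))"
proof -
  have "(1 - A * x) * (1 - B * x) = 1 - (A + B) * x + (A * B) * x\<^sup>2"
    by (simp add: algebra_simps power2_eq_square)
  then have "(1 - A * x) * ((1 - B * x) * (1 + x + x\<^sup>2)) = (1 - 3 * x + x\<^sup>2) * (1 + x + x\<^sup>2)"
    unfolding assms by (simp flip: mult.assoc)
  also have "\<dots> = (1 - (x + x\<^sup>2))\<^sup>2 - 4 * x ^ 3"
    by (simp add: algebra_simps power2_eq_square power3_eq_cube)
  finally show ?thesis ..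
qed

text \<open>The product \<open>(1 - x) inv_sqrt_fps\<close> is the square root of
  \<open>1 - x\<close>, so with the last factor it represents \<open>1 + x + x^2\<close> to the
  power -1/2. In the first claim both sides have the same square, as both squares are inverse to the
  quartic \<open>P\<close>; the constant coefficient 1 excludes the opposite sign.\<close>

lemma pairing_fps_factor:
  fixes a b :: real
  assumes ab: "a + b = 3" "a * b = 1"
  defines "g \<equiv> (inv_sqrt_fps oo (fps_const b * fps_X)) * (1 - fps_X) * inv_sqrt_fps * (inv_sqrt_fps oo fps_X ^ 3)"
  shows "pairing_fps = (inv_sqrt_fps oo (fps_const a * fps_X)) * g"
    and "g\<^sup>2 * ((1 - fps_const b * fps_X) * (1 + fps_X + fps_X\<^sup>2)) = 1"
proof -
  let ?i = "\<lambda>c. inv_sqrt_fps oo (fps_const c * fps_X)"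
  let ?A = "fps_const a" and ?B = "fps_const b"
  have lin: "(?i c)\<^sup>2 * (1 - fps_const c * fps_X) = 1" for c
    by (rule inv_sqrt_fps_compose_square) simp
  have cub: "(inv_sqrt_fps oo fps_X ^ 3)\<^sup>2 * (1 - fps_X ^ 3) = 1"
    by (rule inv_sqrt_fps_compose_square) simp
  have "(1 - fps_X) * (1 + fps_X + fps_X\<^sup>2) = (1 - fps_X ^ 3 :: real fps)"
    by (simp add: algebra_simps power2_eq_square power3_eq_cube)
  note cube = this[symmetric]
  have "g\<^sup>2 * ((1 - ?B * fps_X) * (1 + fps_X + fps_X\<^sup>2)) =
      ((?i b)\<^sup>2 * (1 - ?B * fps_X)) * (inv_sqrt_fps\<^sup>2 * (1 - fps_X)) * ((inv_sqrt_fps oo fps_X ^ 3)\<^sup>2 * (1 - fps_X ^ 3))"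
    unfolding g_def cube power2_eq_square by (simp only: mult_ac)
  also have "\<dots> = 1" by (simp only: lin cub inv_sqrt_fps_square mult_1)
  finally show g: "g\<^sup>2 * ((1 - ?B * fps_X) * (1 + fps_X + fps_X\<^sup>2)) = 1" .
  define P :: "real fps" where "P = (1 - (fps_X + fps_X\<^sup>2))\<^sup>2 - 4 * fps_X ^ 3"
  have AB: "?A + ?B = 3" "?A * ?B = 1"
    by (simp_all add: ab numeral_fps_const)
  have P: "P = (1 - ?A * fps_X) * ((1 - ?B * fps_X) * (1 + fps_X + fps_X\<^sup>2))"
    unfolding P_def by (rule quartic_factor[OF AB])
  let ?h = "?i a * g"
  have P1: "pairing_fps\<^sup>2 * P = 1" unfolding P_def by (rule pairing_fps_square)
  have "?h\<^sup>2 * P = ((?i a)\<^sup>2 * (1 - ?A * fps_X)) * (g\<^sup>2 * ((1 - ?B * fps_X) * (1 + fps_X + fps_X\<^sup>2)))"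
    unfolding P by (simp only: power_mult_distrib mult_ac)
  also have "\<dots> = 1" by (simp only: lin g mult_1)
  finally have "?h\<^sup>2 * P = pairing_fps\<^sup>2 * P" by (simp only: P1)
  moreover have "P \<noteq> 0" using P1 by auto
  ultimately have "?h\<^sup>2 = pairing_fps\<^sup>2" by simp
  then have "?h = pairing_fps \<or> ?h = - pairing_fps" by (simp add: power2_eq_iff)
  moreover have "?h \<noteq> - pairing_fps"
  proof
    assume "?h = - pairing_fps"
    then have "?h $ 0 = - (pairing_fps $ 0)" by (simp only: fps_neg_nth)
    then show False by (simp add: g_def pairing_fps_def inv_sqrt_fps_def)
  qed
  ultimately show "pairing_fps = ?h" by auto
qed

text \<open>The factor at \<open>a = \<phi>^2\<close> contributes the growth and the convolution
  with \<open>cbin\<close>; the other factor \<open>g\<close> enters the leading term only through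
  its value \<open>G\<close> at \<open>b = 1 / a\<close>.\<close>

lemma pairing_fps_asymp:
  fixes \<phi> :: real
  assumes phi: "\<phi> = (1 + sqrt 5) / 2"
  obtains K where "\<And>n. n \<ge> 1 \<Longrightarrow>
    \<bar>pairing_fps $ n - \<phi> ^ (2 * n + 2) / (2 * root 4 5 * sqrt (pi * real n))\<bar>
      \<le> K * (\<phi> ^ (2 * n) / real n powr (3 / 2))"
proof -
  define a b where "a = \<phi>\<^sup>2" and "b = 1 / \<phi>\<^sup>2"
  have phi1: "\<phi>\<^sup>2 = \<phi> + 1" unfolding phi by (simp add: power2_eq_square field_simps)
  have "\<phi> > 1" by (simp add: phi)
  then have ab: "a * b = 1" "b > 0" "b < 1" "a > 0" "a > 1" 
    by (simp_all add: a_def b_def one_less_power)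
  have b: "b = 2 - \<phi>"
  proof -
    have "(2 - \<phi>) * \<phi>\<^sup>2 = 1" using phi1 by (simp add: power2_eq_square) algebra
    then show ?thesis using \<open>\<phi> > 1\<close> by (simp add: b_def field_simps)
  qed
  have ab3: "a + b = 3" by (simp add: b a_def phi1)
  define g where "g = (inv_sqrt_fps oo (fps_const b * fps_X)) * (1 - fps_X) * inv_sqrt_fps * (inv_sqrt_fps oo fps_X ^ 3)"
  note F = pairing_fps_factor(1)[OF ab3 ab(1), folded g_def]
  note g2 = pairing_fps_factor(2)[OF ab3 ab(1), folded g_def]
  let ?f1 = "inv_sqrt_fps oo (fps_const b * fps_X)" and ?f3 = "inv_sqrt_fps oo fps_X ^ 3"
  have nth1: "0 \<le> ?f1 $ k" "\<bar>?f1 $ k\<bar> \<le> 1" for k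
  proof -
    show "0 \<le> ?f1 $ k" using cbin_pos[of k] ab by (simp add: inv_sqrt_fps_def)
    moreover have "b ^ k * cbin k \<le> 1 * 1"
      using cbin_pos[of k] cbin_le_1[of k] ab by (intro mult_mono power_le_one) auto
    ultimately show "\<bar>?f1 $ k\<bar> \<le> 1" by (simp add: inv_sqrt_fps_def)
  qed
  have nth2: "0 \<le> inv_sqrt_fps $ k" "\<bar>inv_sqrt_fps $ k\<bar> \<le> 1" for k
    using cbin_pos[of k] cbin_le_1[of k] by (simp_all add: inv_sqrt_fps_def)
  have nth3: "0 \<le> ?f3 $ k" "\<bar>?f3 $ k\<bar> \<le> 1" for k
    using nth2[of "k div 3"] by (auto simp: fps_nth_compose_X_power)
  note cr = fps_conv_radius_ge_1[OF nth1(2)] fps_conv_radius_ge_1[OF nth2(2)] fps_conv_radius_ge_1[OF nth3(2)]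
  have crm: "fps_conv_radius (p * q) \<ge> 1" if "fps_conv_radius p \<ge> 1" "fps_conv_radius q \<ge> 1" for p q :: "real fps"
    using fps_conv_radius_mult[of p q] that by (meson min.boundedI order_trans)
  have crd: "fps_conv_radius (1 - fps_X :: real fps) \<ge> 1"
    using fps_conv_radius_diff[of "1 :: real fps" fps_X] by simp
  have crg: "fps_conv_radius g \<ge> 1" unfolding g_def by (intro crm cr crd)
  have less: "ereal (norm b) < fps_conv_radius p" if "fps_conv_radius p \<ge> 1" for p :: "real fps"
    using ab that by (auto intro: less_le_trans[of _ 1])
  have mul: "eval_fps (p * q) b = eval_fps p b * eval_fps q b"
    if "fps_conv_radius p \<ge> 1" "fps_conv_radius q \<ge> 1" for p q :: "real fps"
    by (intro eval_fps_mult less that)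
  define G where "G = eval_fps g b"
  have "eval_fps (1 - fps_X) b = 1 - b" by (simp add: eval_fps_diff)
  then have "G = eval_fps ?f1 b * (1 - b) * eval_fps inv_sqrt_fps b * eval_fps ?f3 b"
    unfolding G_def g_def by (simp add: mul crm cr crd)
  moreover have "eval_fps ?f1 b > 0" "eval_fps inv_sqrt_fps b > 0" "eval_fps ?f3 b > 0"
    by (rule eval_fps_pos; use nth1 nth2 nth3 cr ab in \<open>simp add: inv_sqrt_fps_def\<close>)+
  ultimately have "G > 0" using ab by simp
  \<comment> \<open>\<open>G\<close> is found up to sign by evaluating \<open>g2\<close> at
    \<open>b\<close>; all radii are at least 1 and \<open>b < 1\<close>, so evaluation is
    multiplicative.\<close>
  have "G\<^sup>2 * ((1 - b * b) * (1 + b + b\<^sup>2)) = 1"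
  proof -
    define p q :: "real fps" where "p = 1 - fps_const b * fps_X" and "q = 1 + fps_X + fps_X\<^sup>2"
    have c: "fps_conv_radius (fps_const b * fps_X) = \<infinity>" "fps_conv_radius (1 + fps_X :: real fps) \<ge> 1"
      using ab fps_conv_radius_add[of 1 "fps_X :: real fps"] by (simp_all add: fps_conv_radius_cmult_left)
    have cp: "fps_conv_radius p \<ge> 1" "fps_conv_radius q \<ge> 1"
      using fps_conv_radius_diff[of 1 "fps_const b * fps_X"] fps_conv_radius_add[of "1 + fps_X :: real fps" "fps_X\<^sup>2"] c
      by (auto simp: p_def q_def intro: order_trans[rotated])
    have "eval_fps (g\<^sup>2 * (p * q)) b = G\<^sup>2 * (eval_fps p b * eval_fps q b)"
      unfolding G_def power2_eq_square by (simp add: mul crm cp crg)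
    moreover have "eval_fps p b = 1 - b * b"
      using c by (simp add: p_def eval_fps_diff eval_fps_mult)
    moreover have "eval_fps q b = 1 + b + b\<^sup>2"
      using less[OF c(2)] by (simp add: q_def eval_fps_add)
    ultimately show ?thesis using g2 by (simp add: p_def q_def)
  qed
  \<comment> \<open>Both sides equal \<open>4 sqrt 5 b^2\<close>: with
    \<open>sqrt 5 = 2 \<phi> - 1\<close> and \<open>b = 2 - \<phi>\<close> this is a polynomial
    identity modulo \<open>\<phi>^2 = \<phi> + 1\<close>.\<close>
  moreover have "(1 - b * b) * (1 + b + b\<^sup>2) = (2 * root 4 5 / \<phi>\<^sup>2)\<^sup>2"
  proof -
    have "(root 4 5)\<^sup>2 = sqrt 5"
    proof -
      have "((root 4 5)\<^sup>2)\<^sup>2 = (5::real)" by (simp flip: power_mult)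
      then show ?thesis by (metis real_sqrt_unique zero_le_power2)
    qed
    then have "(2 * root 4 5 / \<phi>\<^sup>2)\<^sup>2 = 4 * sqrt 5 * b\<^sup>2"
      by (simp add: b_def power_mult_distrib power_divide)
    also have "sqrt 5 = 2 * \<phi> - 1" by (simp add: phi field_simps)
    also have "4 * (2 * \<phi> - 1) * b\<^sup>2 = (1 - b * b) * (1 + b + b\<^sup>2)"
      unfolding b using phi1 by algebra
    finally show ?thesis ..
  qed
  ultimately have "(G * (2 * root 4 5 / \<phi>\<^sup>2))\<^sup>2 = 1" by (simp only: power_mult_distrib)
  moreover have "G * (2 * root 4 5 / \<phi>\<^sup>2) > 0" using \<open>G > 0\<close> \<open>\<phi> > 1\<close> by simp
  ultimately have "G * (2 * root 4 5 / \<phi>\<^sup>2) = 1" unfolding power2_eq_1_iff by linarith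
  then have G: "G = \<phi>\<^sup>2 / (2 * root 4 5)" using \<open>\<phi> > 1\<close> by (simp add: field_simps)
  define w where "w k = g $ k * b ^ k" for k
  define C where "C = (\<Sum>k. (real k + 1) ^ 3 * \<bar>w k\<bar>)"
  have sw: "summable (\<lambda>k. (real k + 1) ^ 3 * \<bar>w k\<bar>)"
    unfolding w_def by (rule summable_cube_times_fps) (use ab crg in auto)
  then have "C \<ge> 0" unfolding C_def by (intro suminf_nonneg) auto
  have G': "G = (\<Sum>k. w k)" by (simp add: G_def eval_fps_def w_def)
  have Fn: "pairing_fps $ n = \<phi> ^ (2 * n) * (\<Sum>k\<le>n. cbin (n - k) * w k)" for n
  proof -
    have "pairing_fps $ n = (\<Sum>k\<le>n. (a ^ (n - k) * cbin (n - k)) * g $ k)"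
      unfolding F
      by (simp only: mult.commute[of _ g] fps_mult_nth atLeast0AtMost inv_sqrt_fps_compose_linear_nth)
        (simp only: mult_ac)
    \<comment> \<open>As \<open>a * b = 1\<close>, \<open>a ^ (n - k)\<close> is
      \<open>a ^ n * b ^ k\<close>: the first factor is pulled out and the second goes into
      \<open>w k\<close>.\<close>
    also have "\<dots> = (\<Sum>k\<le>n. \<phi> ^ (2 * n) * (cbin (n - k) * w k))"
    proof (rule sum.cong[OF refl])
      fix k assume "k \<in> {..n}"
      then have "a ^ n = a ^ (n - k) * a ^ k" by (simp flip: power_add)
      then have "a ^ n * b ^ k = a ^ (n - k) * (a * b) ^ k" by (simp add: power_mult_distrib)
      then have "a ^ (n - k) = \<phi> ^ (2 * n) * b ^ k" using ab by (simp add: a_def power_mult)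
      then show "(a ^ (n - k) * cbin (n - k)) * g $ k = \<phi> ^ (2 * n) * (cbin (n - k) * w k)"
        by (simp add: w_def)
    qed
    finally show ?thesis by (simp add: sum_distrib_left)
  qed
  show ?thesis
  proof (rule that)
    fix n :: nat assume n: "n \<ge> 1"
    let ?p = "real n powr (- (3 / 2))"
    define S where "S = (\<Sum>k\<le>n. cbin (n - k) * w k)"
    \<comment> \<open>Two errors of the same order are added: one from replacing the convolution by
      \<open>cbin n * G\<close>, one from replacing \<open>cbin n\<close> by
      \<open>1 / sqrt (pi n)\<close>.\<close>
    have "\<bar>S - cbin n * G\<bar> \<le> C * (real n + 1) powr (- (3 / 2))"
      unfolding S_def G' C_def by (rule cbin_convolution[OF sw])
    also have "\<dots> \<le> C * ?p" using n \<open>C \<ge> 0\<close> by (intro mult_left_mono powr_mono2') auto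
    finally have 1: "\<bar>S - cbin n * G\<bar> \<le> C * ?p" .
    have "\<bar>cbin n * G - 1 / sqrt (pi * real n) * G\<bar> = \<bar>cbin n - 1 / sqrt (pi * real n)\<bar> * G"
      using \<open>G > 0\<close> by (simp only: left_diff_distrib[symmetric] abs_mult abs_of_pos)
    also have "\<dots> \<le> ?p * G" using cbin_asymp[OF n] \<open>G > 0\<close> by (intro mult_right_mono) auto
    finally have "\<bar>S - 1 / sqrt (pi * real n) * G\<bar> \<le> (C + G) * ?p"
      using 1 by (simp only: distrib_right mult.commute[of G])
    then have "\<phi> ^ (2 * n) * \<bar>S - 1 / sqrt (pi * real n) * G\<bar> \<le> \<phi> ^ (2 * n) * ((C + G) * ?p)"
      using \<open>\<phi> > 1\<close> by (intro mult_left_mono) auto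
    also have "\<phi> ^ (2 * n) * \<bar>S - 1 / sqrt (pi * real n) * G\<bar>
        = \<bar>pairing_fps $ n - \<phi> ^ (2 * n + 2) / (2 * root 4 5 * sqrt (pi * real n))\<bar>"
    proof -
      have "\<phi> ^ (2 * n) * \<bar>S - 1 / sqrt (pi * real n) * G\<bar> = \<bar>\<phi> ^ (2 * n) * (S - 1 / sqrt (pi * real n) * G)\<bar>"
        using \<open>\<phi> > 1\<close> by (simp add: abs_mult)
      also have "\<phi> ^ (2 * n) * (S - 1 / sqrt (pi * real n) * G)
        = pairing_fps $ n - \<phi> ^ (2 * n + 2) / (2 * root 4 5 * sqrt (pi * real n))"
        by (simp only: Fn S_def G power_add) (simp add: algebra_simps)
      finally show ?thesis .
    qed
    finally show "\<bar>pairing_fps $ n - \<phi> ^ (2 * n + 2) / (2 * root 4 5 * sqrt (pi * real n))\<bar>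
      \<le> (C + G) * (\<phi> ^ (2 * n) / real n powr (3 / 2))"
      by (simp add: powr_minus field_simps)
  qed
qed

theorem theorem10:
  fixes a :: "nat \<Rightarrow> nat \<Rightarrow> nat" and r :: "nat \<Rightarrow> nat" and \<phi> :: real
  assumes a: "\<And>p q. \<exists>A B. marked_points p q A B \<and> a p q = card (noncrossing_pairings (A \<union> B))"
    and r: "\<And>n. r n = a n n"
    and phi: "\<phi> = (1 + sqrt 5) / 2"
  shows "(\<lambda>n. real (r n) - \<phi> ^ (2 * n + 2) / (2 * root 4 5 * sqrt (pi * real n)))
           \<in> O(\<lambda>n. \<phi> ^ (2 * n) / real n powr (3 / 2))"
proof -
  \<comment> \<open>The count depends only on the numbers of points, so whichever configuration
    realises \<open>a n n\<close> gives \<open>pairing_number n n\<close>.\<close>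
  have rn: "real (r n) = pairing_fps $ n" for n
  proof -
    obtain A B where "marked_points n n A B" "a n n = card (noncrossing_pairings (A \<union> B))"
      using a by blast
    then have "a n n = pairing_number n n"
      using card_noncrossing_pairings_marked_points by simp
    then show ?thesis by (simp add: r pairing_number_diag pairing_fps_def)
  qed
  obtain K where K: "\<And>n. n \<ge> 1 \<Longrightarrow>
    \<bar>pairing_fps $ n - \<phi> ^ (2 * n + 2) / (2 * root 4 5 * sqrt (pi * real n))\<bar>
      \<le> K * (\<phi> ^ (2 * n) / real n powr (3 / 2))"
    using pairing_fps_asymp[OF phi] by blast
  show ?thesis
  proof (rule bigoI[of _ K], rule eventually_sequentiallyI[of 1])
    fix n :: nat assume "1 \<le> n"
    moreover have "0 \<le> \<phi>" by (simp add: phi)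
    ultimately show "norm (real (r n) - \<phi> ^ (2 * n + 2) / (2 * root 4 5 * sqrt (pi * real n)))
        \<le> K * norm (\<phi> ^ (2 * n) / real n powr (3 / 2))"
      using K[of n] by (simp only: rn real_norm_def) (simp add: abs_mult)
  qed
qed

end
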